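(* Let $a>0$, let $\Omega=(-a,a)^3\subset\mathbb{R}^3$, and let $T=\mathrm{diam}\,\Omega=2\sqrt3\,a$. Let $f\in C_0^2(\Omega)$ (extended by zero to $\mathbb{R}^3$), let $p(x,t)$ be the solution of the Cauchy problem $$p_{tt}=\Delta_x p,\quad t\ge 0,\ x\in\mathbb{R}^3,\qquad p(x,0)=f(x),\quad p_t(x,0)=0,$$ and let $P(y,t)=p(y,t)$ for $y\in\partial\Omega$, $t\in[0,\infty)$. Then $f$ can be reconstructed from the boundary values $P$ by the following formula: for every $x\in\Omega$, $$f(x)=\frac{1}{2\pi}\,\operatorname{div}_x\sum_{j=1}^{6}\ \int\limits_{(\Pi_j^a\cup\Pi_j^b)\cap B(x,T)} n_j\,\frac{P_j^{\mathrm{repl}}(y,|y-x|)}{|y-x|}\,ds(y),$$ where the planes $\Pi_j^a,\Pi_j^b$, the normals $n_j$ and the replicated data $P_j^{\mathrm{repl}}$ are as defined in the context.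
   Context: $C_0^2(\Omega)$ denotes the twice continuously differentiable functions with compact support in $\Omega$. $B(x,T)$ is the ball of radius $T$ centered at $x$, and $ds(y)$ is the standard area element. Solution of the wave equation: $p$ is given by Kirchhoff's formula $p(x,t)=\frac{\partial}{\partial t}\bigl(tM(x,t)\bigr)$, where $M(x,r)=\frac1{4\pi}\int_{S^2}f(x+r\omega)\,d\omega$. Faces, normals and planes: the six faces of the cube $\Omega$ are $S_1,\dots,S_6$. Each face lies in a plane $\{x_i=\sigma a\}$ for some $i\in\{1,2,3\}$ and $\sigma\in\{+1,-1\}$. If $S_j$ is the face lying in $\{x_i=\sigma a\}$, then $n_j=\sigma e_i$ is the exterior unit normal to $S_j$ ($e_i$ being the $i$-th standard basis vector), $\Pi_j^a=\{x_i=\sigma a\}$ is the plane containing $S_j$, and $\Pi_j^b=\{x_i=-3\sigma a\}$ (the mirror image of $\Pi_j^a$ in the plane of the face opposite to $S_j$). Both planes are equipped with the same normal $n_j$. Replication operator: $E^{2D}$ extends a function $h$ defined on the open square $(-a,a)\times(-a,a)$ to a function $h^{\mathrm{repl}}=E^{2D}h$ on $\mathbb{R}^2$ by odd reflections: for $n,m\in\mathbb{Z}$ and $(\xi_1,\xi_2)$ in the open square of side $2a$ centered at $(2na,2ma)$, $$h^{\mathrm{repl}}(\xi_1,\xi_2)=(-1)^{m+n}h\bigl((-1)^n(\xi_1-2na),\,(-1)^m(\xi_2-2ma)\bigr),$$ and $h^{\mathrm{repl}}=0$ on the boundaries of all these squares. Replicated data: for each $t$, $P_j^{\mathrm{repl}}(\cdot,\cdot,t)=E^{2D}\bigl(P(\cdot,t)|_{S_j}\bigr)$,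 where $P(\cdot,t)|_{S_j}$ is regarded as a function on $(-a,a)^2$ of the two coordinates other than $x_i$. For $y\in\Pi_j^a\cup\Pi_j^b$, $P_j^{\mathrm{repl}}(y,t)$ denotes the value of $P_j^{\mathrm{repl}}(\cdot,\cdot,t)$ at the two coordinates of $y$ other than $y_i$ (so the same replicated data are placed on both planes). *)

theory Defs
  imports "HOL-Analysis.Analysis"
begin

definition open_cube :: "real \<Rightarrow> (real^3) set" where
  "open_cube a = {x. \<forall>i. - a < x $ i \<and> x $ i < a}"

definition C2_on :: "(real^3) set \<Rightarrow> (real^3 \<Rightarrow> real) \<Rightarrow> bool" where
  "C2_on S f \<longleftrightarrow>
     (\<exists>(f' :: real^3 \<Rightarrow> (real^3) \<Rightarrow>\<^sub>L real) (f'' :: real^3 \<Rightarrow> (real^3) \<Rightarrow>\<^sub>L ((real^3) \<Rightarrow>\<^sub>L real)).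
        (\<forall>x\<in>S. (f has_derivative blinfun_apply (f' x)) (at x)) \<and>
        (\<forall>x\<in>S. (f' has_derivative blinfun_apply (f'' x)) (at x)) \<and>
        continuous_on S f'')"

(* The support is taken in the whole space, so such an f is automatically
   its own extension by zero. *)
definition C2_compact_support :: "(real^3) set \<Rightarrow> (real^3 \<Rightarrow> real) \<Rightarrow> bool" where
  "C2_compact_support S f \<longleftrightarrow>
     C2_on S f \<and> compact (closure {x. f x \<noteq> 0}) \<and> closure {x. f x \<noteq> 0} \<subseteq> S"

definition sphere_point :: "real \<times> real \<Rightarrow> real^3" where
  "sphere_point = (\<lambda>(\<theta>, \<phi>). vector [sin \<theta> * cos \<phi>, sin \<theta> * sin \<phi>, cos \<theta>])"

(* Surface integral over the unit sphere in spherical coordinates; sin \<theta> is the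
   area element of this parametrization. *)
definition sphere_integral :: "(real^3 \<Rightarrow> real) \<Rightarrow> real" where
  "sphere_integral g =
     (LINT z:{0..pi} \<times> {0..2 * pi}|lborel. sin (fst z) * g (sphere_point z))"

definition spherical_mean :: "(real^3 \<Rightarrow> real) \<Rightarrow> real^3 \<Rightarrow> real \<Rightarrow> real" where
  "spherical_mean f x r = 1 / (4 * pi) * sphere_integral (\<lambda>\<omega>. f (x + r *\<^sub>R \<omega>))"

(* Kirchhoff's formula for the solution of the wave equation with data (f, 0). *)
definition wave_solution :: "(real^3 \<Rightarrow> real) \<Rightarrow> real^3 \<Rightarrow> real \<Rightarrow> real" where
  "wave_solution f x t = deriv (\<lambda>s. s * spherical_mean f x s) t"

definition coord_plane :: "3 \<Rightarrow> real \<Rightarrow> (real^3) set" where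
  "coord_plane i c = {y. y $ i = c}"

(* Arithmetic in the index type 3 is modulo 3, so i + 1 and i + 2 are the two
   indices different from i. *)
definition plane_point :: "3 \<Rightarrow> real \<Rightarrow> real \<times> real \<Rightarrow> real^3" where
  "plane_point i c z = (\<chi> k. if k = i then c else if k = i + 1 then fst z else snd z)"

definition plane_coords :: "3 \<Rightarrow> real^3 \<Rightarrow> real \<times> real" where
  "plane_coords i y = (y $ (i + 1), y $ (i + 2))"

(* Area measure on coord_plane i c, as a measure on the whole space. *)
definition plane_area :: "3 \<Rightarrow> real \<Rightarrow> (real^3) measure" where
  "plane_area i c = distr lborel borel (plane_point i c)"

(* For a > 0, round (\<xi> / (2 * a)) is the index of the interval of length 2 * a
   containing \<xi>; see replicate2D_cell and replicate2D_boundary below. *)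
definition replicate2D :: "real \<Rightarrow> (real \<times> real \<Rightarrow> real) \<Rightarrow> real \<times> real \<Rightarrow> real" where
  "replicate2D a h = (\<lambda>(\<xi>\<^sub>1, \<xi>\<^sub>2).
     let n = round (\<xi>\<^sub>1 / (2 * a)); m = round (\<xi>\<^sub>2 / (2 * a));
         u = \<xi>\<^sub>1 - 2 * of_int n * a; v = \<xi>\<^sub>2 - 2 * of_int m * a
     in if \<bar>u\<bar> < a \<and> \<bar>v\<bar> < a
        then (-1) powi (m + n) * h ((-1) powi n * u, (-1) powi m * v)
        else 0)"

lemma round_cell:
  fixes a \<xi> :: real
  assumes "\<bar>\<xi> - 2 * of_int n * a\<bar> < a"
  shows "round (\<xi> / (2 * a)) = n"
proof -
  have a: "a > 0" using assms by linarith
  have "\<xi> / (2 * a) - of_int n = (\<xi> - 2 * of_int n * a) / (2 * a)"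
    using a by (simp add: field_simps)
  then have "\<bar>\<xi> / (2 * a) - of_int n\<bar> = \<bar>\<xi> - 2 * of_int n * a\<bar> / (2 * a)"
    using a by simp
  also have "\<dots> < 1 / 2"
    using a assms by (simp add: field_simps)
  finally show ?thesis by (rule round_unique')
qed

lemma replicate2D_cell:
  fixes a \<xi>\<^sub>1 \<xi>\<^sub>2 :: real and n m :: int
  assumes "\<bar>\<xi>\<^sub>1 - 2 * of_int n * a\<bar> < a" "\<bar>\<xi>\<^sub>2 - 2 * of_int m * a\<bar> < a"
  shows "replicate2D a h (\<xi>\<^sub>1, \<xi>\<^sub>2) =
    (-1) powi (m + n) * h ((-1) powi n * (\<xi>\<^sub>1 - 2 * of_int n * a), (-1) powi m * (\<xi>\<^sub>2 - 2 * of_int m * a))"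
  using assms by (simp add: replicate2D_def round_cell)

lemma replicate2D_boundary:
  fixes a \<xi>\<^sub>1 \<xi>\<^sub>2 :: real
  assumes "\<nexists>n m :: int. \<bar>\<xi>\<^sub>1 - 2 * of_int n * a\<bar> < a \<and> \<bar>\<xi>\<^sub>2 - 2 * of_int m * a\<bar> < a"
  shows "replicate2D a h (\<xi>\<^sub>1, \<xi>\<^sub>2) = 0"
  using assms by (auto simp: replicate2D_def Let_def)

(* A face is given by a pair (i, \<sigma>) with \<sigma> = 1 or \<sigma> = -1; it lies in coord_plane i (\<sigma> * a). *)
definition face_normal :: "3 \<Rightarrow> real \<Rightarrow> real^3" where
  "face_normal i \<sigma> = \<sigma> *\<^sub>R axis i 1"

definition replicated_data ::
    "real \<Rightarrow> (real^3 \<Rightarrow> real \<Rightarrow> real) \<Rightarrow> 3 \<Rightarrow> real \<Rightarrow> real^3 \<Rightarrow> real \<Rightarrow> real" where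
  "replicated_data a P i \<sigma> y t =
     replicate2D a (\<lambda>z. P (plane_point i (\<sigma> * a) z) t) (plane_coords i y)"

(* For a > 0 the two planes of a face are disjoint, so the integral over their
   union is the sum over c of the integrals over the single planes. *)
definition face_integral ::
    "real \<Rightarrow> (real^3 \<Rightarrow> real \<Rightarrow> real) \<Rightarrow> real \<Rightarrow> 3 \<Rightarrow> real \<Rightarrow> real^3 \<Rightarrow> real^3" where
  "face_integral a P T i \<sigma> x =
     (\<Sum>c\<in>{\<sigma> * a, - 3 * \<sigma> * a}.
        LINT y:coord_plane i c \<inter> ball x T|plane_area i c.
          (replicated_data a P i \<sigma> y (dist y x) / dist y x) *\<^sub>R face_normal i \<sigma>)"

definition has_divergence :: "(real^3 \<Rightarrow> real^3) \<Rightarrow> real \<Rightarrow> real^3 \<Rightarrow> bool" where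
  "has_divergence F d x \<longleftrightarrow>
     (\<exists>D. (\<forall>i. ((\<lambda>s. F (x + s *\<^sub>R axis i 1) $ i) has_real_derivative D i) (at 0)) \<and>
          d = (\<Sum>i\<in>UNIV. D i))"

lemma diameter_open_cube:
  assumes "a > 0"
  shows "diameter (open_cube a) = 2 * sqrt 3 * a"
proof -
  define l u :: "real^3" where "l = (\<chi> i. - a)" and "u = (\<chi> i. a)"
  have eq: "open_cube a = box l u"
    by (auto simp: open_cube_def mem_box_cart l_def u_def)
  have ne: "box l u \<noteq> {}"
    using assms by (auto simp: interval_ne_empty_cart l_def u_def)
  have le: "\<forall>b\<in>Basis. l \<bullet> b \<le> u \<bullet> b"
    using ne by (force simp: box_ne_empty)
  have "diameter (open_cube a) = diameter (closure (box l u))"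
    by (simp add: eq diameter_closure bounded_box)
  also have "\<dots> = dist l u"
    using ne le by (simp add: closure_box diameter_cbox)
  also have "\<dots> = sqrt (3 * (2 * a)\<^sup>2)"
    by (simp add: dist_vec_def L2_set_def dist_real_def l_def u_def)
  also have "\<dots> = sqrt 3 * sqrt ((2 * a)\<^sup>2)"
    by (rule real_sqrt_mult)
  also have "\<dots> = 2 * sqrt 3 * a"
    using assms by (simp only: real_sqrt_abs)
  finally show ?thesis .
qed

end

theory Submission
  imports Defs
begin

text \<open>Kirchhoff's formula with advanced times expresses a solution \<open>v\<close> of the wave equation at
  \<open>(z, 0)\<close> by a flux through the boundary of the cube, and the same flux is zero when \<open>z\<close> lies
  outside the closed cube. Sum these fluxes, with alternating signs, over the images of \<open>x\<close> under the
  reflections in the planes of the faces. Solutions with data supported in the cube vanish in the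
  cube for \<open>t \<ge> T\<close>, so a given face is reached only by images that form mirror pairs with respect to
  its plane. In each pair the normal derivatives of \<open>v\<close> cancel and the other terms double, and the
  two types of pairs are as far away from the face as \<open>x\<close> is from \<open>\<Pi>\<^sup>a\<close> and \<open>\<Pi>\<^sup>b\<close>. Unfolding the
  tangential reflections turns integrals over the face into integrals of replicated data over the planes.

  Since \<open>p\<close> need only be \<open>C\<^sup>1\<close> when \<open>f\<close> is \<open>C\<^sup>2\<close>, the argument is applied to \<open>v(y, t) = w(y, t + \<tau>)\<close>
  with \<open>w = t M\<close>, \<open>p = w\<^sub>t\<close> and \<open>\<tau> \<ge> 0\<close>, and the resulting identity is differentiated at \<open>\<tau> = 0\<close>.\<close>

section \<open>Functions of class C2\<close>

text \<open>Along each axis only the images with indices -2 to 2 are summed. All of them except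
  \<open>x\<close> lie outside the closed cube, so the alternating sum of the fluxes consists of the
  single term at \<open>x\<close>. With t the coordinate of \<open>x\<close> along the axis, the
  face at height a has the five images at distances a-t (twice), 3a+t (twice) and 5a-t. The last one
  exceeds 4a, which is at least T, and so drops out; 3a+t is the distance of \<open>x\<close> from
  the plane at height -3a, hence the factor -3. The same bound confines \<open>B(x,T)\<close> to
  coordinates below 5a in absolute value, so five cells per tangential direction describe the
  replicated data there.

  The divergence has the following origin. What is left of a mirror pair is a double layer with the
  factor c - x_i. After differentiation in \<tau> it is the derivative in x_i of the single layer
  with density p(y,r)/r, where r is the distance to \<open>x\<close>. The moving boundary of
  \<open>B(x,T)\<close> makes no contribution to this derivative, because the data vanish from time
  T on.\<close>

lemma second_partials_symmetric:
  fixes f :: "real^'n \<Rightarrow> real" and g :: "'n \<Rightarrow> real^'n \<Rightarrow> real"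
  assumes f: "\<And>y. (f has_derivative (\<lambda>v. \<Sum>i\<in>UNIV. v $ i * g i y)) (at y)"
    and g: "\<And>i y. (g i has_derivative (\<lambda>v. \<Sum>j\<in>UNIV. v $ j * h i j y)) (at y)"
    and h: "\<And>i j. continuous_on UNIV (h i j)"
  shows "h i j y = h j i y"
proof -
  define q where "q s t = y + s *\<^sub>R axis i 1 + t *\<^sub>R axis j 1" for s t :: real
  have [simp]: "(\<Sum>k\<in>UNIV. axis l (c::real) $ k * F k) = c * F l" for l :: 'n and c F
    by (simp add: axis_def if_distrib[of "\<lambda>x. x * _"] cong: if_cong)
  have dsx: "((\<lambda>s. F (q s t)) has_real_derivative F' i (q s t)) (at s)"
    and dtx: "((\<lambda>t. F (q s t)) has_real_derivative F' j (q s t)) (at t)"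
    if "\<And>y. (F has_derivative (\<lambda>v. \<Sum>i\<in>UNIV. v $ i * F' i y)) (at y)" for F F' s t
  proof -
    have "((\<lambda>s. F (q s t)) has_derivative (\<lambda>d. \<Sum>k\<in>UNIV. (d *\<^sub>R axis i 1) $ k * F' k (q s t))) (at s)"
      by (rule has_derivative_compose[OF _ that]) (auto simp: q_def intro!: derivative_eq_intros)
    then show "((\<lambda>s. F (q s t)) has_real_derivative F' i (q s t)) (at s)"
      by (simp add: has_field_derivative_def mult.assoc sum_distrib_left[symmetric] mult_commute_abs)
    have "((\<lambda>t. F (q s t)) has_derivative (\<lambda>d. \<Sum>k\<in>UNIV. (d *\<^sub>R axis j 1) $ k * F' k (q s t))) (at t)"
      by (rule has_derivative_compose[OF _ that]) (auto simp: q_def intro!: derivative_eq_intros)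
    then show "((\<lambda>t. F (q s t)) has_real_derivative F' j (q s t)) (at t)"
      by (simp add: has_field_derivative_def mult.assoc sum_distrib_left[symmetric] mult_commute_abs)
  qed
  have qc: "continuous_on UNIV (\<lambda>z. q (fst z) (snd z))"
    unfolding q_def by (intro continuous_intros)
  have gc: "continuous_on UNIV (g j)"
    using g by (meson continuous_at_imp_continuous_on has_derivative_continuous)
  have hqc: "continuous_on S (\<lambda>z. h j i (q (fst z) (snd z)))" for S
    using continuous_on_compose2[OF h qc] continuous_on_subset by blast
  \<comment> \<open>Both sides are the derivative in s at 0 of f (q s t) - f (q s 0), the integral
    of \<open>g j\<close> along an edge: once directly, once under the integral sign.
    Differentiating in t at 0 then compares the two mixed partials.\<close>
  have eq: "g i (q 0 t) - g i (q 0 0) = integral {0..t} (\<lambda>u. h j i (q 0 u))" if t: "t \<in> {0..1}" for t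
  proof -
    have ftc: "((\<lambda>u. g j (q s u)) has_integral f (q s t) - f (q s 0)) {0..t}" for s
      using t dtx[OF f]
      by (intro fundamental_theorem_of_calculus)
        (auto simp: has_real_derivative_iff_has_vector_derivative[symmetric]
          intro: has_field_derivative_at_within)
    have "((\<lambda>s. integral (cbox 0 t) (\<lambda>u. g j (q s u))) has_real_derivative
       integral (cbox 0 t) (\<lambda>u. h j i (q 0 u))) (at 0 within UNIV)"
    proof (rule leibniz_rule_field_derivative)
      show "((\<lambda>s. g j (q s u)) has_real_derivative h j i (q s u)) (at s within UNIV)" for s u
        using dsx[OF g] by simp
      show "(\<lambda>u. g j (q s u)) integrable_on cbox 0 t" for s
        using ftc by auto
      show "continuous_on (UNIV \<times> cbox 0 t) (\<lambda>(s, u). h j i (q s u))"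
        using hqc by (simp add: split_beta)
    qed auto
    moreover have "integral (cbox 0 t) (\<lambda>u. g j (q s u)) = f (q s t) - f (q s 0)" for s
      using ftc by (simp add: integral_unique)
    ultimately have "((\<lambda>s. f (q s t) - f (q s 0)) has_real_derivative
       integral {0..t} (\<lambda>u. h j i (q 0 u))) (at 0)" by simp
    moreover have "((\<lambda>s. f (q s t) - f (q s 0)) has_real_derivative g i (q 0 t) - g i (q 0 0)) (at 0)"
      by (intro derivative_intros dsx f)
    ultimately show ?thesis by (metis DERIV_unique)
  qed
  have hq1: "continuous_on {0..1} (\<lambda>u. h j i (q 0 u))"
    by (rule continuous_on_compose2[OF h]) (auto simp: q_def intro!: continuous_intros)
  have "((\<lambda>t. integral {0..t} (\<lambda>u. h j i (q 0 u))) has_real_derivative h j i (q 0 0)) (at 0 within {0..1})"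
    using integral_has_real_derivative[OF hq1] by auto
  moreover have "((\<lambda>t. integral {0..t} (\<lambda>u. h j i (q 0 u))) has_real_derivative h i j (q 0 0)) (at 0 within {0..1})"
  proof (rule has_field_derivative_transform_within[where d=1 and f="\<lambda>t. g i (q 0 t) - g i (q 0 0)"])
    show "((\<lambda>t. g i (q 0 t) - g i (q 0 0)) has_real_derivative h i j (q 0 0)) (at 0 within {0..1})"
      by (auto intro!: derivative_eq_intros has_field_derivative_at_within[OF dtx[OF g]])
  qed (use eq in auto)
  moreover have "at (0::real) within {0..1} \<noteq> bot"
    by (simp add: trivial_limit_within islimpt_Icc)
  ultimately have "h j i (q 0 0) = h i j (q 0 0)"
    by (metis has_field_derivative_unique)
  then show ?thesis by (simp add: q_def)
qed

text \<open>The derivatives in \<open>C2_on\<close> are given on S only. On the open complement Z of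
  the support f is 0, so their extensions by 0 are consistent there, and S and Z are open and cover
  the space. Componentwise partials replace the linear maps for the calculations below.\<close>

lemma C2_compact_supportE:
  fixes f :: "real^3 \<Rightarrow> real"
  assumes S: "open S" and f: "C2_compact_support S f"
  obtains g :: "3 \<Rightarrow> real^3 \<Rightarrow> real" and h :: "3 \<Rightarrow> 3 \<Rightarrow> real^3 \<Rightarrow> real"
  where "\<And>y. (f has_derivative (\<lambda>v. \<Sum>i\<in>UNIV. v $ i * g i y)) (at y)"
    and "\<And>i y. (g i has_derivative (\<lambda>v. \<Sum>j\<in>UNIV. v $ j * h i j y)) (at y)"
    and "\<And>i j. continuous_on UNIV (h i j)"
    and "\<And>y. y \<notin> S \<Longrightarrow> f y = 0"
    and "\<And>i y. y \<notin> S \<Longrightarrow> g i y = 0"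
    and "\<And>i j y. y \<notin> S \<Longrightarrow> h i j y = 0"
proof -
  obtain f' :: "real^3 \<Rightarrow> (real^3) \<Rightarrow>\<^sub>L real" and f'' :: "real^3 \<Rightarrow> (real^3) \<Rightarrow>\<^sub>L ((real^3) \<Rightarrow>\<^sub>L real)" where
    f': "\<And>x. x\<in>S \<Longrightarrow> (f has_derivative blinfun_apply (f' x)) (at x)" and
    f'': "\<And>x. x\<in>S \<Longrightarrow> (f' has_derivative blinfun_apply (f'' x)) (at x)" and
    c: "continuous_on S f''" and supp: "closure {x. f x \<noteq> 0} \<subseteq> S"
    using f unfolding C2_compact_support_def C2_on_def by blast
  define Z where "Z = - closure {x. f x \<noteq> 0}"
  have Z: "open Z" "\<And>y. y \<in> Z \<Longrightarrow> f y = 0" "\<And>y. y \<notin> S \<Longrightarrow> y \<in> Z" "\<And>y. y \<notin> Z \<Longrightarrow> y \<in> S"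
    using supp closure_subset[of "{x. f x \<noteq> 0}"] by (auto simp: Z_def)
  have lin: "(\<Sum>i\<in>UNIV. v $ i * L (axis i 1)) = L v" if "linear L" for L :: "real^3 \<Rightarrow> real" and v
  proof -
    have "L v = L (\<Sum>i\<in>UNIV. v $ i *\<^sub>R axis i 1)"
      by (simp add: basis_expansion flip: scalar_mult_eq_scaleR)
    also have "\<dots> = (\<Sum>i\<in>UNIV. v $ i * L (axis i 1))"
      using that by (simp add: linear_sum linear_cmul)
    finally show ?thesis by simp
  qed
  have f'0: "f' y = 0" if "y \<in> S" "y \<in> Z" for y
  proof -
    have "(f has_derivative (\<lambda>_. 0)) (at y)"
      by (rule has_derivative_transform_within_open[OF has_derivative_const[of 0] Z(1) that(2)])
        (use Z in auto)
    with f'[OF that(1)] have "blinfun_apply (f' y) = (\<lambda>_. 0)"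
      by (rule has_derivative_unique)
    then show ?thesis by (intro blinfun_eqI) simp
  qed
  have f''0: "f'' y = 0" if "y \<in> S" "y \<in> Z" for y
  proof -
    have "(f' has_derivative (\<lambda>_. 0)) (at y)"
      by (rule has_derivative_transform_within_open[OF has_derivative_const[of 0], of "S \<inter> Z"])
        (use Z S that f'0 in auto)
    with f''[OF that(1)] have "blinfun_apply (f'' y) = (\<lambda>_. 0)"
      by (rule has_derivative_unique)
    then show ?thesis by (intro blinfun_eqI) simp
  qed
  define g where "g i y = (if y \<in> S then f' y (axis i 1) else 0)" for i y
  define h where "h i j y = (if y \<in> S then f'' y (axis j 1) (axis i 1) else 0)" for i j y
  have gZ: "g i y = 0" if "y \<in> Z" for i y using f'0 that by (auto simp: g_def)
  have hZ: "h i j y = 0" if "y \<in> Z" for i j y using f''0 that by (auto simp: h_def)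
  show thesis
  proof
    fix i j :: 3 and y :: "real^3"
    show "y \<notin> S \<Longrightarrow> f y = 0" "y \<notin> S \<Longrightarrow> g i y = 0" "y \<notin> S \<Longrightarrow> h i j y = 0"
      using Z(2,3)[of y] by (auto simp: g_def h_def)
    show "(f has_derivative (\<lambda>v. \<Sum>i\<in>UNIV. v $ i * g i y)) (at y)"
    proof (cases "y \<in> S")
      case True
      then have "(\<lambda>v. \<Sum>i\<in>UNIV. v $ i * g i y) = blinfun_apply (f' y)"
        using lin[OF bounded_linear.linear[OF blinfun.bounded_linear_right]] by (auto simp: g_def)
      with f'[OF True] show ?thesis by simp
    next
      case False
      show ?thesis
        by (rule has_derivative_transform_within_open[OF has_derivative_eq_rhs[OF has_derivative_const[of 0]] Z(1) Z(3)[OF False]])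
          (use Z gZ False in auto)
    qed
    show "(g i has_derivative (\<lambda>v. \<Sum>j\<in>UNIV. v $ j * h i j y)) (at y)"
    proof (cases "y \<in> S")
      case True
      have "linear (\<lambda>v. f'' y v (axis i 1))"
        by (intro linearI) (auto simp: blinfun.bilinear_simps)
      from lin[OF this] have eq: "(\<lambda>v. \<Sum>j\<in>UNIV. v $ j * h i j y) = (\<lambda>v. f'' y v (axis i 1))"
        using True by (auto simp: h_def)
      have "((\<lambda>y. f' y (axis i 1)) has_derivative (\<lambda>v. f'' y v (axis i 1))) (at y)"
        by (auto intro!: derivative_eq_intros f''[OF True])
      then show ?thesis unfolding eq
        by (rule has_derivative_transform_within_open[OF _ S True]) (simp add: g_def)
    next
      case False
      show ?thesis
        by (rule has_derivative_transform_within_open[OF has_derivative_eq_rhs[OF has_derivative_const[of 0]] Z(1) Z(3)[OF False]])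
          (use Z gZ hZ False in auto)
    qed
    have "continuous_on (S \<union> Z) (h i j)"
    proof (rule continuous_on_open_Un[OF S Z(1)])
      have "continuous_on S (\<lambda>y. f'' y (axis j 1) (axis i 1))"
        by (intro continuous_intros c)
      then show "continuous_on S (h i j)"
        by (rule continuous_on_eq) (simp add: h_def)
      show "continuous_on Z (h i j)"
        by (rule continuous_on_eq[of _ "\<lambda>_. 0"]) (auto simp: hZ)
    qed
    moreover have "S \<union> Z = UNIV" using Z by auto
    ultimately show "continuous_on UNIV (h i j)" by simp
  qed
qed

section \<open>Spherical means\<close>

abbreviation sphere_rect :: "(real \<times> real) set" where
  "sphere_rect \<equiv> cbox (0, 0) (pi, 2 * pi)"

section \<open>The orthonormal frame of spherical coordinates\<close>

definition polar_tangent :: "real \<times> real \<Rightarrow> real^3" where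
  "polar_tangent = (\<lambda>(\<theta>, \<phi>). vector [cos \<theta> * cos \<phi>, cos \<theta> * sin \<phi>, - sin \<theta>])"

text \<open>The \<phi>-derivative of \<open>sphere_point\<close> is sin \<theta> times this vector.
  Without that factor it has length 1 even at the poles and completes \<open>sphere_point\<close>
  and \<open>polar_tangent\<close> to an orthonormal frame.\<close>

definition azimuthal_tangent :: "real \<times> real \<Rightarrow> real^3" where
  "azimuthal_tangent = (\<lambda>(\<theta>, \<phi>). vector [- sin \<phi>, cos \<phi>, 0])"


lemma continuous_on_vector3 [continuous_intros]:
  fixes f1 f2 f3 :: "'a::t2_space \<Rightarrow> real"
  assumes "continuous_on S f1" "continuous_on S f2" "continuous_on S f3"
  shows "continuous_on S (\<lambda>x. vector [f1 x, f2 x, f3 x] :: real^3)"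
proof (rule continuous_on_componentwise[THEN iffD2], rule ballI)
  have "\<forall>i. continuous_on S (\<lambda>x. (vector [f1 x, f2 x, f3 x] :: real^3) $ i)"
    using assms by (simp add: forall_3)
  then show "continuous_on S (\<lambda>x. (vector [f1 x, f2 x, f3 x] :: real^3) \<bullet> b)" if "b \<in> Basis" for b
    using that by (auto simp: Basis_vec_def inner_axis)
qed

lemma sphere_point_nth:
  "sphere_point (\<theta>, \<phi>) $ 1 = sin \<theta> * cos \<phi>" "sphere_point (\<theta>, \<phi>) $ 2 = sin \<theta> * sin \<phi>"
  "sphere_point (\<theta>, \<phi>) $ 3 = cos \<theta>"
  by (simp_all add: sphere_point_def)

lemma polar_tangent_nth:
  "polar_tangent (\<theta>, \<phi>) $ 1 = cos \<theta> * cos \<phi>" "polar_tangent (\<theta>, \<phi>) $ 2 = cos \<theta> * sin \<phi>"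
  "polar_tangent (\<theta>, \<phi>) $ 3 = - sin \<theta>"
  by (simp_all add: polar_tangent_def)

lemma azimuthal_tangent_nth:
  "azimuthal_tangent (\<theta>, \<phi>) $ 1 = - sin \<phi>" "azimuthal_tangent (\<theta>, \<phi>) $ 2 = cos \<phi>"
  "azimuthal_tangent (\<theta>, \<phi>) $ 3 = 0"
  by (simp_all add: azimuthal_tangent_def)

lemmas frame_nth = sphere_point_nth polar_tangent_nth azimuthal_tangent_nth

lemma continuous_on_frame [continuous_intros]:
  fixes k :: "'a::t2_space \<Rightarrow> real \<times> real"
  assumes "continuous_on S k"
  shows "continuous_on S (\<lambda>x. sphere_point (k x))" "continuous_on S (\<lambda>x. polar_tangent (k x))"
    "continuous_on S (\<lambda>x. azimuthal_tangent (k x))"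
  unfolding sphere_point_def polar_tangent_def azimuthal_tangent_def split_beta
  by (intro continuous_intros assms; simp add: assms)+

lemma norm_sphere_point: "norm (sphere_point z) = 1"
proof -
  obtain \<theta> \<phi> where z: "z = (\<theta>, \<phi>)" by (cases z)
  have "(sin \<theta> * cos \<phi>)\<^sup>2 + (sin \<theta> * sin \<phi>)\<^sup>2 + (cos \<theta>)\<^sup>2
      = (sin \<theta>)\<^sup>2 * ((cos \<phi>)\<^sup>2 + (sin \<phi>)\<^sup>2) + (cos \<theta>)\<^sup>2"
    by (simp only: power_mult_distrib distrib_left)
  also have "\<dots> = 1" by simp
  finally show ?thesis
    by (simp add: z norm_vec_def L2_set_def sum_3 frame_nth)
qed

text \<open>An orthonormal frame resolves the identity matrix, so the two tangent terms add up to
  the projection onto the tangent plane. Contracted with the Hessian, this gives the Laplacian minus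
  the second radial derivative.\<close>

lemma frame_completeness:
  "polar_tangent z $ i * polar_tangent z $ j + azimuthal_tangent z $ i * azimuthal_tangent z $ j
    = (if i = j then 1 else 0) - sphere_point z $ i * sphere_point z $ j"
proof -
  obtain \<theta> \<phi> where z: "z = (\<theta>, \<phi>)" by (cases z)
  have s1: "(sin \<theta>)\<^sup>2 + (cos \<theta>)\<^sup>2 = 1" and s2: "(sin \<phi>)\<^sup>2 + (cos \<phi>)\<^sup>2 = 1" by auto
  have "\<forall>i j. polar_tangent z $ i * polar_tangent z $ j + azimuthal_tangent z $ i * azimuthal_tangent z $ j
    = (if i = j then 1 else 0) - sphere_point z $ i * sphere_point z $ j"
    unfolding forall_3 z frame_nth using s1 s2
    by (simp; intro conjI; algebra)
  then show ?thesis by blast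
qed

lemma frame_derivatives:
  "((\<lambda>\<theta>. sphere_point (\<theta>, \<phi>) $ i) has_real_derivative polar_tangent (\<theta>, \<phi>) $ i) (at \<theta>)"
  "((\<lambda>\<theta>. polar_tangent (\<theta>, \<phi>) $ i) has_real_derivative - sphere_point (\<theta>, \<phi>) $ i) (at \<theta>)"
  "((\<lambda>\<phi>. sphere_point (\<theta>, \<phi>) $ i) has_real_derivative sin \<theta> * azimuthal_tangent (\<theta>, \<phi>) $ i) (at \<phi>)"
  "((\<lambda>\<phi>. azimuthal_tangent (\<theta>, \<phi>) $ i) has_real_derivative
     - (sin \<theta> * sphere_point (\<theta>, \<phi>) $ i + cos \<theta> * polar_tangent (\<theta>, \<phi>) $ i)) (at \<phi>)"
proof -
  \<comment> \<open>Up to sign the \<phi>-derivative of \<open>azimuthal_tangent\<close> is the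
    horizontal vector (cos \<phi>, sin \<phi>, 0); these identities resolve it along the other two
    vectors of the frame.\<close>
  have e: "cos \<phi> = sin \<theta> * (sin \<theta> * cos \<phi>) + cos \<theta> * (cos \<theta> * cos \<phi>)"
    "sin \<phi> = sin \<theta> * (sin \<theta> * sin \<phi>) + cos \<theta> * (cos \<theta> * sin \<phi>)"
    using sin_cos_squared_add[of \<theta>] by algebra+
  have "\<forall>i. ((\<lambda>\<theta>. sphere_point (\<theta>, \<phi>) $ i) has_real_derivative polar_tangent (\<theta>, \<phi>) $ i) (at \<theta>)"
    "\<forall>i. ((\<lambda>\<theta>. polar_tangent (\<theta>, \<phi>) $ i) has_real_derivative - sphere_point (\<theta>, \<phi>) $ i) (at \<theta>)"
    "\<forall>i. ((\<lambda>\<phi>. sphere_point (\<theta>, \<phi>) $ i) has_real_derivative sin \<theta> * azimuthal_tangent (\<theta>, \<phi>) $ i) (at \<phi>)"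
    "\<forall>i. ((\<lambda>\<phi>. azimuthal_tangent (\<theta>, \<phi>) $ i) has_real_derivative
     - (sin \<theta> * sphere_point (\<theta>, \<phi>) $ i + cos \<theta> * polar_tangent (\<theta>, \<phi>) $ i)) (at \<phi>)"
    unfolding forall_3 frame_nth using e
    by (auto intro!: derivative_eq_intros)
  then show 
  "((\<lambda>\<theta>. sphere_point (\<theta>, \<phi>) $ i) has_real_derivative polar_tangent (\<theta>, \<phi>) $ i) (at \<theta>)"
  "((\<lambda>\<theta>. polar_tangent (\<theta>, \<phi>) $ i) has_real_derivative - sphere_point (\<theta>, \<phi>) $ i) (at \<theta>)"
  "((\<lambda>\<phi>. sphere_point (\<theta>, \<phi>) $ i) has_real_derivative sin \<theta> * azimuthal_tangent (\<theta>, \<phi>) $ i) (at \<phi>)"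
  "((\<lambda>\<phi>. azimuthal_tangent (\<theta>, \<phi>) $ i) has_real_derivative
     - (sin \<theta> * sphere_point (\<theta>, \<phi>) $ i + cos \<theta> * polar_tangent (\<theta>, \<phi>) $ i)) (at \<phi>)"
    by blast+
qed

section \<open>Weighted spherical averages and differentiation under the integral\<close>

definition sphere_avg :: "(real \<times> real \<Rightarrow> real) \<Rightarrow> (real^3 \<Rightarrow> real) \<Rightarrow> (real^3) \<times> real \<Rightarrow> real" where
  "sphere_avg k \<phi> q =
     1 / (4 * pi) * integral sphere_rect (\<lambda>z. sin (fst z) * k z * \<phi> (fst q + snd q *\<^sub>R sphere_point z))"

lemma sphere_avg_continuous:
  assumes k: "continuous_on UNIV k" and \<phi>: "continuous_on UNIV \<phi>"
  shows "continuous_on UNIV (sphere_avg k \<phi>)"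
  unfolding sphere_avg_def
  by (intro continuous_intros integral_continuous_on_param[where f="\<lambda>q z. _ q z"])
    (auto simp: split_beta intro!: continuous_intros continuous_on_compose2[OF k] continuous_on_compose2[OF \<phi>])

text \<open>A derivative in space falls on \<phi> alone; a derivative in t also brings down a
  component of the unit vector, which the weight k absorbs. Averages with polynomial weights are
  thus closed under differentiation. Negative t is included, so time 0 is an interior point.\<close>

lemma sphere_avg_has_derivative:
  assumes k: "continuous_on UNIV k"
    and \<phi>: "\<And>y. (\<phi> has_derivative (\<lambda>v. \<Sum>i\<in>UNIV. v $ i * \<phi>' i y)) (at y)"
    and \<phi>': "\<And>i. continuous_on UNIV (\<phi>' i)"
  shows "(sphere_avg k \<phi> has_derivative
     (\<lambda>u. (\<Sum>i\<in>UNIV. fst u $ i * sphere_avg k (\<phi>' i) q) +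
        snd u * (\<Sum>i\<in>UNIV. sphere_avg (\<lambda>z. k z * sphere_point z $ i) (\<phi>' i) q))) (at q)"
proof -
  \<comment> \<open>The Leibniz rule asks for a derivative that is continuous as a map into the
    bounded linear functionals. Expressed through the fixed functionals \<open>Y i\<close> and
    \<open>T\<close>, it has continuous real coefficients.\<close>
  define Y :: "3 \<Rightarrow> ((real^3) \<times> real) \<Rightarrow>\<^sub>L real" where "Y i = Blinfun (\<lambda>u. fst u $ i)" for i
  define T :: "((real^3) \<times> real) \<Rightarrow>\<^sub>L real" where "T = Blinfun snd"
  have Y: "blinfun_apply (Y i) u = fst u $ i" for i u
    unfolding Y_def by (subst bounded_linear_Blinfun_apply)
      (auto intro: bounded_linear_compose[OF bounded_linear_vec_nth bounded_linear_fst])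
  have T: "blinfun_apply T u = snd u" for u
    unfolding T_def by (simp add: bounded_linear_Blinfun_apply bounded_linear_snd)
  define L where "L q z = fst q + snd q *\<^sub>R sphere_point z" for q :: "(real^3) \<times> real" and z
  define D where "D q z = (\<Sum>i\<in>UNIV. (sin (fst z) * k z * \<phi>' i (L q z)) *\<^sub>R (Y i + sphere_point z $ i *\<^sub>R T))" for q z
  have \<phi>c: "continuous_on UNIV \<phi>"
    using \<phi> by (meson continuous_at_imp_continuous_on has_derivative_continuous)
  have Lc: "continuous_on S (\<lambda>x. L (a x) (b x))" if "continuous_on S a" "continuous_on S b"
    for S :: "'c::t2_space set" and a b
    unfolding L_def by (intro continuous_intros that)
  have "((\<lambda>q. integral sphere_rect (\<lambda>z. sin (fst z) * k z * \<phi> (L q z))) has_derivative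
       integral sphere_rect (D q)) (at q within UNIV)"
  proof (rule leibniz_rule)
    fix q z
    have "(L p z = fst p + snd p *\<^sub>R sphere_point z)" for p by (simp add: L_def)
    then have "((\<lambda>q. L q z) has_derivative (\<lambda>u. L u z)) (at q)"
      by (auto intro!: derivative_eq_intros)
    from has_derivative_compose[OF this \<phi>]
    have "((\<lambda>q. \<phi> (L q z)) has_derivative (\<lambda>u. \<Sum>i\<in>UNIV. L u z $ i * \<phi>' i (L q z))) (at q)" .
    from has_derivative_mult_right[OF this, of "sin (fst z) * k z"]
    show "((\<lambda>q. sin (fst z) * k z * \<phi> (L q z)) has_derivative blinfun_apply (D q z)) (at q within UNIV)"
      by (rule has_derivative_eq_rhs)
        (auto simp: D_def fun_eq_iff blinfun.bilinear_simps blinfun.sum_left Y T L_def sum_distrib_left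
           algebra_simps intro!: sum.cong)
  next
    show "(\<lambda>z. sin (fst z) * k z * \<phi> (L q z)) integrable_on sphere_rect" for q
      by (intro integrable_continuous continuous_intros continuous_on_compose2[OF k]
          continuous_on_compose2[OF \<phi>c] Lc) auto
    show "continuous_on (UNIV \<times> sphere_rect) (\<lambda>(q, z). D q z)"
      unfolding D_def split_beta
      by (intro continuous_intros continuous_on_compose2[OF k] continuous_on_compose2[OF \<phi>'] Lc) auto
  qed auto
  then have d: "((\<lambda>q. integral sphere_rect (\<lambda>z. sin (fst z) * k z * \<phi> (L q z))) has_derivative
       integral sphere_rect (D q)) (at q)" by simp
  have i1: "(\<lambda>z. sin (fst z) * k z * \<phi>' i (L q z)) integrable_on sphere_rect"
    and i2: "(\<lambda>z. sin (fst z) * (k z * sphere_point z $ i) * \<phi>' i (L q z)) integrable_on sphere_rect" for i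
    by (intro integrable_continuous continuous_intros continuous_on_compose2[OF k]
          continuous_on_compose2[OF \<phi>'] Lc; simp)+
  have "blinfun_apply (integral sphere_rect (D q)) u =
     (\<Sum>i\<in>UNIV. fst u $ i * integral sphere_rect (\<lambda>z. sin (fst z) * k z * \<phi>' i (L q z))) +
        snd u * (\<Sum>i\<in>UNIV. integral sphere_rect (\<lambda>z. sin (fst z) * (k z * sphere_point z $ i) * \<phi>' i (L q z)))" for u
  proof -
    have "D q integrable_on sphere_rect"
      unfolding D_def
      by (intro integrable_continuous continuous_intros continuous_on_compose2[OF k]
          continuous_on_compose2[OF \<phi>'] Lc) auto
    then have "blinfun_apply (integral sphere_rect (D q)) u = integral sphere_rect (\<lambda>z. D q z u)"
      by (rule blinfun_apply_integral)
    also have "(\<lambda>z. D q z u) = (\<lambda>z. (\<Sum>i\<in>UNIV. fst u $ i * (sin (fst z) * k z * \<phi>' i (L q z)))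
        + snd u * (\<Sum>i\<in>UNIV. sin (fst z) * (k z * sphere_point z $ i) * \<phi>' i (L q z)))"
      by (auto simp: D_def fun_eq_iff blinfun.bilinear_simps blinfun.sum_left Y T sum_distrib_left
           algebra_simps sum.distrib intro!: sum.cong)
    also have "integral sphere_rect \<dots> = (\<Sum>i\<in>UNIV. fst u $ i * integral sphere_rect (\<lambda>z. sin (fst z) * k z * \<phi>' i (L q z))) +
        snd u * (\<Sum>i\<in>UNIV. integral sphere_rect (\<lambda>z. sin (fst z) * (k z * sphere_point z $ i) * \<phi>' i (L q z)))"
      by (subst integral_add) (auto intro!: integrable_sum integrable_on_mult_right i1 i2
           simp: integral_sum integrable_on_mult_right i1 i2)
    finally show ?thesis .
  qed
  then have "blinfun_apply (integral sphere_rect (D q)) = (\<lambda>u. 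
     (\<Sum>i\<in>UNIV. fst u $ i * integral sphere_rect (\<lambda>z. sin (fst z) * k z * \<phi>' i (L q z))) +
        snd u * (\<Sum>i\<in>UNIV. integral sphere_rect (\<lambda>z. sin (fst z) * (k z * sphere_point z $ i) * \<phi>' i (L q z))))"
    by blast
  from has_derivative_mult_right[OF d, of "1 / (4 * pi)", unfolded this]
  show ?thesis
    unfolding sphere_avg_def[abs_def] L_def
    by (rule has_derivative_eq_rhs) (simp add: fun_eq_iff sum_distrib_left distrib_left mult.left_commute)
qed

lemma DERIV_along_curve:
  fixes c :: "real \<Rightarrow> real^'n"
  assumes \<phi>: "(\<phi> has_derivative (\<lambda>v. \<Sum>i\<in>UNIV. v $ i * G i)) (at (c s))"
    and c: "\<And>i. ((\<lambda>s. c s $ i) has_real_derivative c' i) (at s)"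
  shows "((\<lambda>s. \<phi> (c s)) has_real_derivative (\<Sum>i\<in>UNIV. c' i * G i)) (at s)"
proof -
  have "(c has_derivative (\<lambda>d. d *\<^sub>R (\<chi> i. c' i))) (at s)"
    using c by (subst has_derivative_componentwise_within)
      (auto simp: Basis_vec_def inner_axis has_field_derivative_def mult_commute_abs)
  from has_derivative_compose[OF this \<phi>] show ?thesis
    unfolding has_field_derivative_def
    by (rule has_derivative_eq_rhs) (simp add: fun_eq_iff sum_distrib_left ac_simps)
qed

lemma sphere_avg_sum:
  assumes "\<And>i. i \<in> I \<Longrightarrow> continuous_on UNIV (k i)" "\<And>i. i \<in> I \<Longrightarrow> continuous_on UNIV (\<phi> i)"
  shows "(\<Sum>i\<in>I. sphere_avg (k i) (\<phi> i) (y, t)) =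
    1 / (4 * pi) * integral sphere_rect (\<lambda>z. \<Sum>i\<in>I. sin (fst z) * k i z * \<phi> i (y + t *\<^sub>R sphere_point z))"
proof (cases "finite I")
  case True
  have "(\<lambda>z. sin (fst z) * k i z * \<phi> i (y + t *\<^sub>R sphere_point z)) integrable_on sphere_rect" if "i \<in> I" for i
    using that by (intro integrable_continuous continuous_intros continuous_on_compose2[OF assms(1)]
        continuous_on_compose2[OF assms(2)]) auto
  then have "integral sphere_rect (\<lambda>z. \<Sum>i\<in>I. sin (fst z) * k i z * \<phi> i (y + t *\<^sub>R sphere_point z))
    = (\<Sum>i\<in>I. integral sphere_rect (\<lambda>z. sin (fst z) * k i z * \<phi> i (y + t *\<^sub>R sphere_point z)))"
    by (intro integral_sum True)
  then show ?thesis by (simp add: sphere_avg_def sum_distrib_left)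
qed auto

lemma integral_sphere_rect_swap:
  fixes F :: "real \<times> real \<Rightarrow> real"
  assumes "continuous_on sphere_rect F"
  shows "integral sphere_rect F = integral {0..pi} (\<lambda>\<theta>. integral {0..2 * pi} (\<lambda>\<phi>. F (\<theta>, \<phi>)))"
    and "integral sphere_rect F = integral {0..2 * pi} (\<lambda>\<phi>. integral {0..pi} (\<lambda>\<theta>. F (\<theta>, \<phi>)))"
  using integral_prod_continuous[OF assms] integral_swap_continuous[of 0 0 pi "2 * pi" "\<lambda>x y. F (x, y)"] assms
  by simp_all

text \<open>The radial derivatives of the spherical mean can be traded for the Laplacian, because the
  difference is the integral of the two total derivatives
  \<open>\<partial>\<^sub>\<theta> (sin \<theta> (e\<^sub>\<theta> \<bullet> \<nabla>f))\<close> and \<open>\<partial>\<^sub>\<phi> (e\<^sub>\<phi> \<bullet> \<nabla>f)\<close>.\<close>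

lemma sphere_avg_laplacian:
  fixes g :: "3 \<Rightarrow> real^3 \<Rightarrow> real"
  assumes g: "\<And>i y. (g i has_derivative (\<lambda>v. \<Sum>j\<in>UNIV. v $ j * h i j y)) (at y)"
    and h: "\<And>i j. continuous_on UNIV (h i j)"
  shows "t * (\<Sum>i\<in>UNIV. sphere_avg (\<lambda>_. 1) (h i i) (y, t)) =
     2 * (\<Sum>i\<in>UNIV. sphere_avg (\<lambda>z. sphere_point z $ i) (g i) (y, t)) +
     t * (\<Sum>i\<in>UNIV. \<Sum>j\<in>UNIV. sphere_avg (\<lambda>z. sphere_point z $ i * sphere_point z $ j) (h i j) (y, t))"
proof -
  note frame_continuous = continuous_intros continuous_on_component
  have gc: "continuous_on UNIV (g i)" for i
    using g by (meson continuous_at_imp_continuous_on has_derivative_continuous)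
  define q where "q z = y + t *\<^sub>R sphere_point z" for z
  have qc: "continuous_on S q" for S
    unfolding q_def by (intro continuous_intros)
  define D1 where "D1 z = cos (fst z) * (\<Sum>i\<in>UNIV. polar_tangent z $ i * g i (q z)) +
    sin (fst z) * (\<Sum>i\<in>UNIV. polar_tangent z $ i * (\<Sum>j\<in>UNIV. t * polar_tangent z $ j * h i j (q z))
        - sphere_point z $ i * g i (q z))" for z
  define D2 where "D2 z = (\<Sum>i\<in>UNIV.
      azimuthal_tangent z $ i * (\<Sum>j\<in>UNIV. t * (sin (fst z) * azimuthal_tangent z $ j) * h i j (q z))
      - (sin (fst z) * sphere_point z $ i + cos (fst z) * polar_tangent z $ i) * g i (q z))" for z
  have c1: "continuous_on S D1" and c2: "continuous_on S D2" for S
    unfolding D1_def D2_def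
    by (intro continuous_intros continuous_on_compose2[OF gc qc] continuous_on_compose2[OF h qc]; simp)+
  have "((\<lambda>\<theta>. D1 (\<theta>, \<phi>)) has_integral
      sin pi * (\<Sum>i\<in>UNIV. polar_tangent (pi, \<phi>) $ i * g i (q (pi, \<phi>))) -
      sin 0 * (\<Sum>i\<in>UNIV. polar_tangent (0, \<phi>) $ i * g i (q (0, \<phi>)))) {0..pi}" for \<phi>
  proof (rule fundamental_theorem_of_calculus)
    fix \<theta>
    have q: "((\<lambda>\<theta>. q (\<theta>, \<phi>) $ j) has_real_derivative t * polar_tangent (\<theta>, \<phi>) $ j) (at \<theta>)" for j
      unfolding q_def by (auto intro!: derivative_eq_intros frame_derivatives)
    have "((\<lambda>\<theta>. sin \<theta> * (\<Sum>i\<in>UNIV. polar_tangent (\<theta>, \<phi>) $ i * g i (q (\<theta>, \<phi>))))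
      has_real_derivative D1 (\<theta>, \<phi>)) (at \<theta>)"
      unfolding D1_def
      by (rule derivative_eq_intros frame_derivatives DERIV_along_curve g q refl)+
        (simp add: algebra_simps sum_subtractf sum.distrib)
    then show "((\<lambda>\<theta>. sin \<theta> * (\<Sum>i\<in>UNIV. polar_tangent (\<theta>, \<phi>) $ i * g i (q (\<theta>, \<phi>))))
      has_vector_derivative D1 (\<theta>, \<phi>)) (at \<theta> within {0..pi})"
      by (simp add: has_field_derivative_at_within has_real_derivative_iff_has_vector_derivative[symmetric])
  qed simp
  \<comment> \<open>The boundary terms carry the factors sin 0 and sin pi, so the poles contribute
    nothing.\<close>
  from integral_unique[OF this] have I1: "integral sphere_rect D1 = 0"
    by (subst integral_sphere_rect_swap(2)[OF c1]) simp
  have "((\<lambda>\<phi>. D2 (\<theta>, \<phi>)) has_integral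
      (\<Sum>i\<in>UNIV. azimuthal_tangent (\<theta>, 2 * pi) $ i * g i (q (\<theta>, 2 * pi))) -
      (\<Sum>i\<in>UNIV. azimuthal_tangent (\<theta>, 0) $ i * g i (q (\<theta>, 0)))) {0..2 * pi}" for \<theta>
  proof (rule fundamental_theorem_of_calculus)
    fix \<phi>
    have q: "((\<lambda>\<phi>. q (\<theta>, \<phi>) $ j) has_real_derivative t * (sin \<theta> * azimuthal_tangent (\<theta>, \<phi>) $ j)) (at \<phi>)" for j
      unfolding q_def by (auto intro!: derivative_eq_intros frame_derivatives)
    have "((\<lambda>\<phi>. \<Sum>i\<in>UNIV. azimuthal_tangent (\<theta>, \<phi>) $ i * g i (q (\<theta>, \<phi>)))
      has_real_derivative D2 (\<theta>, \<phi>)) (at \<phi>)"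
      unfolding D2_def
      by (rule derivative_eq_intros frame_derivatives DERIV_along_curve g q refl)+
        (simp add: algebra_simps sum_subtractf sum.distrib)
    then show "((\<lambda>\<phi>. \<Sum>i\<in>UNIV. azimuthal_tangent (\<theta>, \<phi>) $ i * g i (q (\<theta>, \<phi>)))
      has_vector_derivative D2 (\<theta>, \<phi>)) (at \<phi> within {0..2 * pi})"
      by (simp add: has_field_derivative_at_within has_real_derivative_iff_has_vector_derivative[symmetric])
  qed simp
  note ftc2 = integral_unique[OF this]
  have "q (\<theta>, 2 * pi) = q (\<theta>, 0)" "azimuthal_tangent (\<theta>, 2 * pi) = azimuthal_tangent (\<theta>, 0)" for \<theta>
    by (simp_all add: q_def sphere_point_def azimuthal_tangent_def)
  then have I2: "integral sphere_rect D2 = 0"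
    by (subst integral_sphere_rect_swap(1)[OF c2]) (simp add: ftc2)
  define E1 where "E1 z = (\<Sum>i\<in>UNIV. sin (fst z) * 1 * h i i (q z))" for z
  define E2 where "E2 z = (\<Sum>i\<in>UNIV. sin (fst z) * sphere_point z $ i * g i (q z))" for z
  define E3 where "E3 z = (\<Sum>(i, j)\<in>UNIV. sin (fst z) * (sphere_point z $ i * sphere_point z $ j) * h i j (q z))" for z
  \<comment> \<open>The terms with cos \<theta> cancel between \<open>D1\<close> and
    \<open>D2\<close>. Each of the two leaves one radial term with factor - sin \<theta>, whence the
    factor 2; the second-order terms combine by \<open>frame_completeness\<close>.\<close>
  have E: "D1 z + D2 z = t * E1 z - 2 * E2 z - t * E3 z" for z
  proof -
    have "D1 z + D2 z = t * sin (fst z) * (\<Sum>i\<in>UNIV. \<Sum>j\<in>UNIV. (polar_tangent z $ i * polar_tangent z $ j +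
        azimuthal_tangent z $ i * azimuthal_tangent z $ j) * h i j (q z)) - 2 * E2 z"
      unfolding D1_def D2_def E2_def
      by (simp add: sum_distrib_left sum_distrib_right sum_subtractf sum.distrib algebra_simps)
    also have "(\<Sum>i\<in>UNIV. \<Sum>j\<in>UNIV. (polar_tangent z $ i * polar_tangent z $ j +
        azimuthal_tangent z $ i * azimuthal_tangent z $ j) * h i j (q z)) =
        (\<Sum>i\<in>UNIV. h i i (q z)) - (\<Sum>i\<in>UNIV. \<Sum>j\<in>UNIV. sphere_point z $ i * sphere_point z $ j * h i j (q z))"
      unfolding frame_completeness
      by (simp add: left_diff_distrib sum_subtractf if_distrib[of "\<lambda>x. x * _"] cong: if_cong)
    finally show ?thesis
      unfolding E1_def E3_def
      by (simp add: UNIV_Times_UNIV[symmetric] sum.cartesian_product[symmetric] sum_distrib_left 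
          right_diff_distrib algebra_simps del: UNIV_Times_UNIV)
  qed
  have cE: "continuous_on sphere_rect E1" "continuous_on sphere_rect E2" "continuous_on sphere_rect E3"
    unfolding E1_def E2_def E3_def split_beta
    by (intro continuous_intros continuous_on_compose2[OF gc qc] continuous_on_compose2[OF h qc]; simp)+
  have "0 = integral sphere_rect (\<lambda>z. D1 z + D2 z)"
    using integral_add[OF integrable_continuous[OF c1] integrable_continuous[OF c2], of "(0,0)" "(pi, 2 * pi)"] I1 I2
    by simp
  also have "\<dots> = t * integral sphere_rect E1 - 2 * integral sphere_rect E2 - t * integral sphere_rect E3"
    unfolding E
    by (subst integral_diff integral_mult_right, (intro integrable_continuous continuous_intros cE)+)+ simp
  finally have "t * integral sphere_rect E1 = 2 * integral sphere_rect E2 + t * integral sphere_rect E3"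
    by simp
  from arg_cong[OF this, of "\<lambda>x. 1 / (4 * pi) * x"]
  have eq: "t * (1 / (4 * pi) * integral sphere_rect E1) = 2 * (1 / (4 * pi) * integral sphere_rect E2)
     + t * (1 / (4 * pi) * integral sphere_rect E3)"
    by (simp add: algebra_simps)
  have "(\<Sum>i\<in>UNIV. sphere_avg (\<lambda>_. 1) (h i i) (y, t)) = 1 / (4 * pi) * integral sphere_rect E1"
    unfolding E1_def q_def by (rule sphere_avg_sum) (auto intro: h continuous_intros)
  moreover have "(\<Sum>i\<in>UNIV. sphere_avg (\<lambda>z. sphere_point z $ i) (g i) (y, t)) = 1 / (4 * pi) * integral sphere_rect E2"
    unfolding E2_def q_def by (rule sphere_avg_sum) (intro gc continuous_intros)+
  moreover have "(\<Sum>(i, j)\<in>UNIV. sphere_avg (\<lambda>z. sphere_point z $ i * sphere_point z $ j) (h i j) (y, t))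
      = 1 / (4 * pi) * integral sphere_rect E3"
    unfolding E3_def q_def split_beta by (rule sphere_avg_sum) (intro h continuous_intros)+
  moreover have "(\<Sum>(i, j)\<in>UNIV. sphere_avg (\<lambda>z. sphere_point z $ i * sphere_point z $ j) (h i j) (y, t))
      = (\<Sum>i\<in>UNIV. \<Sum>j\<in>UNIV. sphere_avg (\<lambda>z. sphere_point z $ i * sphere_point z $ j) (h i j) (y, t))"
    by (simp add: UNIV_Times_UNIV[symmetric] sum.cartesian_product[symmetric] del: UNIV_Times_UNIV)
  ultimately show ?thesis using eq by simp
qed

lemma sphere_integral_eq:
  assumes "continuous_on UNIV F"
  shows "sphere_integral F = integral sphere_rect (\<lambda>z. sin (fst z) * F (sphere_point z))"
proof -
  have r: "{0..pi} \<times> {0..2 * pi} = sphere_rect"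
    by (simp add: cbox_Pair_eq)
  have "continuous_on sphere_rect (\<lambda>z. sin (fst z) * F (sphere_point z))"
    by (intro continuous_intros continuous_on_compose2[OF assms]) auto
  then have "set_integrable lborel sphere_rect (\<lambda>z. sin (fst z) * F (sphere_point z))"
    unfolding set_integrable_def by (intro borel_integrable_compact) auto
  from set_borel_integral_eq_integral(2)[OF this] show ?thesis
    by (simp add: sphere_integral_def r)
qed

lemma spherical_mean_eq:
  assumes "continuous_on UNIV f"
  shows "spherical_mean f y t = sphere_avg (\<lambda>_. 1) f (y, t)"
  unfolding spherical_mean_def sphere_avg_def
  by (subst sphere_integral_eq) (auto intro!: continuous_intros continuous_on_compose2[OF assms])

lemma sphere_avg_at_0: "sphere_avg (\<lambda>_. 1) f (y, 0) = f y"
proof -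
  have "((\<lambda>\<theta>. 2 * pi * (sin \<theta> * f y)) has_integral - (2 * pi * cos pi * f y) - - (2 * pi * cos 0 * f y)) {0..pi}"
    by (rule fundamental_theorem_of_calculus)
      (auto intro!: derivative_eq_intros simp: has_real_derivative_iff_has_vector_derivative[symmetric])
  from integral_unique[OF this] show ?thesis
    unfolding sphere_avg_def
    by (subst integral_sphere_rect_swap(1)) (auto intro!: continuous_intros)
qed

text \<open>A solution of the wave equation together with those derivatives that enter Kirchhoff's
  formula; \<open>vxt\<close> is at the same time \<open>\<partial>\<^sub>t vx\<close> and \<open>\<partial>\<^sub>x vt\<close>.\<close>

locale C2_wave =
  fixes v vt vtt :: "(real^3) \<times> real \<Rightarrow> real"
    and vx vxt :: "3 \<Rightarrow> (real^3) \<times> real \<Rightarrow> real"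
    and vxx :: "3 \<Rightarrow> 3 \<Rightarrow> (real^3) \<times> real \<Rightarrow> real"
  assumes v_der: "\<And>q. (v has_derivative (\<lambda>u. (\<Sum>i\<in>UNIV. fst u $ i * vx i q) + snd u * vt q)) (at q)"
    and vx_der: "\<And>i q. (vx i has_derivative (\<lambda>u. (\<Sum>j\<in>UNIV. fst u $ j * vxx i j q) + snd u * vxt i q)) (at q)"
    and vt_der: "\<And>q. (vt has_derivative (\<lambda>u. (\<Sum>j\<in>UNIV. fst u $ j * vxt j q) + snd u * vtt q)) (at q)"
    and vxx_cont: "\<And>i j. continuous_on UNIV (vxx i j)"
    and vxt_cont: "\<And>i. continuous_on UNIV (vxt i)"
    and vtt_cont: "continuous_on UNIV vtt"
    and wave: "\<And>q. vtt q = (\<Sum>i\<in>UNIV. vxx i i q)"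

lemma (in C2_wave) time_shift:
  "C2_wave (\<lambda>q. v (fst q, snd q + \<tau>)) (\<lambda>q. vt (fst q, snd q + \<tau>)) (\<lambda>q. vtt (fst q, snd q + \<tau>))
     (\<lambda>i q. vx i (fst q, snd q + \<tau>)) (\<lambda>i q. vxt i (fst q, snd q + \<tau>)) (\<lambda>i j q. vxx i j (fst q, snd q + \<tau>))"
proof -
  have s: "((\<lambda>q. (fst q, snd q + \<tau>)) has_derivative (\<lambda>u. u)) (at q)" for q :: "(real^3) \<times> real"
    by (auto intro!: derivative_eq_intros)
  have c: "continuous_on UNIV (\<lambda>q :: (real^3) \<times> real. (fst q, snd q + \<tau>))"
    by (intro continuous_intros)
  show ?thesis
    by unfold_locales (auto intro!: has_derivative_compose[OF s] v_der vx_der vt_der wave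
        continuous_on_compose2[OF vxx_cont c] continuous_on_compose2[OF vxt_cont c] continuous_on_compose2[OF vtt_cont c])
qed

text \<open>For the spherical mean M, the function t M has second time derivative 2 M_t + t M_tt,
  which \<open>sphere_avg_laplacian\<close> equates with t times the mean of the Laplacian
  (Darboux's equation). Symmetry of the second partials of f makes the gradient of \<open>vt\<close>
  and the time derivative of \<open>vx\<close> the same function \<open>vxt\<close>.\<close>

lemma C2_wave_spherical_mean:
  fixes f :: "real^3 \<Rightarrow> real" and g :: "3 \<Rightarrow> real^3 \<Rightarrow> real"
  assumes f: "\<And>y. (f has_derivative (\<lambda>v. \<Sum>i\<in>UNIV. v $ i * g i y)) (at y)"
    and g: "\<And>i y. (g i has_derivative (\<lambda>v. \<Sum>j\<in>UNIV. v $ j * h i j y)) (at y)"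
    and h: "\<And>i j. continuous_on UNIV (h i j)"
  shows "C2_wave (\<lambda>q. snd q * sphere_avg (\<lambda>_. 1) f q)
     (\<lambda>q. sphere_avg (\<lambda>_. 1) f q + snd q * (\<Sum>i\<in>UNIV. sphere_avg (\<lambda>z. sphere_point z $ i) (g i) q))
     (\<lambda>q. 2 * (\<Sum>i\<in>UNIV. sphere_avg (\<lambda>z. sphere_point z $ i) (g i) q)
        + snd q * (\<Sum>i\<in>UNIV. \<Sum>j\<in>UNIV. sphere_avg (\<lambda>z. sphere_point z $ i * sphere_point z $ j) (h i j) q))
     (\<lambda>i q. snd q * sphere_avg (\<lambda>_. 1) (g i) q)
     (\<lambda>i q. sphere_avg (\<lambda>_. 1) (g i) q + snd q * (\<Sum>j\<in>UNIV. sphere_avg (\<lambda>z. sphere_point z $ j) (h i j) q))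
     (\<lambda>i j q. snd q * sphere_avg (\<lambda>_. 1) (h i j) q)"
proof -
  have gc: "continuous_on UNIV (g i)" for i
    using g by (meson continuous_at_imp_continuous_on has_derivative_continuous)
  have sym: "h i j = h j i" for i j
    using second_partials_symmetric[OF f g h] by blast
  have c: "continuous_on UNIV (\<lambda>z. sphere_point z $ i)" for i
    by (intro continuous_intros)
  have df: "(sphere_avg (\<lambda>_. 1) f has_derivative
     (\<lambda>u. (\<Sum>i\<in>UNIV. fst u $ i * sphere_avg (\<lambda>_. 1) (g i) q) +
        snd u * (\<Sum>i\<in>UNIV. sphere_avg (\<lambda>z. sphere_point z $ i) (g i) q))) (at q)" for q
    using sphere_avg_has_derivative[OF _ f gc, of "\<lambda>_. 1"] by simp
  have dg: "(sphere_avg (\<lambda>_. 1) (g i) has_derivative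
     (\<lambda>u. (\<Sum>j\<in>UNIV. fst u $ j * sphere_avg (\<lambda>_. 1) (h i j) q) +
        snd u * (\<Sum>j\<in>UNIV. sphere_avg (\<lambda>z. sphere_point z $ j) (h i j) q))) (at q)" for i q
    using sphere_avg_has_derivative[OF _ g h, of "\<lambda>_. 1"] by simp
  note dg' = sphere_avg_has_derivative[OF c g h]
  show ?thesis
  proof
    fix q :: "(real^3) \<times> real" and i j :: 3
    show "((\<lambda>q. snd q * sphere_avg (\<lambda>_. 1) f q) has_derivative
       (\<lambda>u. (\<Sum>i\<in>UNIV. fst u $ i * (snd q * sphere_avg (\<lambda>_. 1) (g i) q)) + snd u *
          (sphere_avg (\<lambda>_. 1) f q + snd q * (\<Sum>i\<in>UNIV. sphere_avg (\<lambda>z. sphere_point z $ i) (g i) q)))) (at q)"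
      by (rule has_derivative_eq_rhs, (rule derivative_eq_intros df refl)+)
        (simp add: fun_eq_iff sum_distrib_left algebra_simps)
    show "((\<lambda>q. snd q * sphere_avg (\<lambda>_. 1) (g i) q) has_derivative
       (\<lambda>u. (\<Sum>j\<in>UNIV. fst u $ j * (snd q * sphere_avg (\<lambda>_. 1) (h i j) q)) + snd u *
          (sphere_avg (\<lambda>_. 1) (g i) q + snd q * (\<Sum>j\<in>UNIV. sphere_avg (\<lambda>z. sphere_point z $ j) (h i j) q)))) (at q)"
      by (rule has_derivative_eq_rhs, (rule derivative_eq_intros dg refl)+)
        (simp add: fun_eq_iff sum_distrib_left algebra_simps)
    show "((\<lambda>q. sphere_avg (\<lambda>_. 1) f q + snd q * (\<Sum>i\<in>UNIV. sphere_avg (\<lambda>z. sphere_point z $ i) (g i) q)) has_derivative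
       (\<lambda>u. (\<Sum>j\<in>UNIV. fst u $ j * (sphere_avg (\<lambda>_. 1) (g j) q + snd q * (\<Sum>i\<in>UNIV. sphere_avg (\<lambda>z. sphere_point z $ i) (h j i) q)))
         + snd u * (2 * (\<Sum>i\<in>UNIV. sphere_avg (\<lambda>z. sphere_point z $ i) (g i) q)
        + snd q * (\<Sum>i\<in>UNIV. \<Sum>j\<in>UNIV. sphere_avg (\<lambda>z. sphere_point z $ i * sphere_point z $ j) (h i j) q)))) (at q)"
    proof (rule has_derivative_eq_rhs, (rule derivative_eq_intros df dg' refl)+, rule ext)
      fix u :: "(real^3) \<times> real"
      have "(\<Sum>i\<in>UNIV. \<Sum>j\<in>UNIV. fst u $ j * sphere_avg (\<lambda>z. sphere_point z $ i) (h i j) q) =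
        (\<Sum>j\<in>UNIV. fst u $ j * (\<Sum>i\<in>UNIV. sphere_avg (\<lambda>z. sphere_point z $ i) (h j i) q))"
        by (subst sum.swap) (simp add: sum_distrib_left sym)
      then show "(\<Sum>i\<in>UNIV. fst u $ i * sphere_avg (\<lambda>_. 1) (g i) q) +
           snd u * (\<Sum>i\<in>UNIV. sphere_avg (\<lambda>z. sphere_point z $ i) (g i) q) +
           (snd q * (\<Sum>i\<in>UNIV. (\<Sum>j\<in>UNIV. fst u $ j * sphere_avg (\<lambda>z. sphere_point z $ i) (h i j) q) +
              snd u * (\<Sum>j\<in>UNIV. sphere_avg (\<lambda>z. sphere_point z $ i * sphere_point z $ j) (h i j) q)) +
            snd u * (\<Sum>i\<in>UNIV. sphere_avg (\<lambda>z. sphere_point z $ i) (g i) q)) =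
        (\<Sum>j\<in>UNIV. fst u $ j * (sphere_avg (\<lambda>_. 1) (g j) q + snd q * (\<Sum>i\<in>UNIV. sphere_avg (\<lambda>z. sphere_point z $ i) (h j i) q)))
         + snd u * (2 * (\<Sum>i\<in>UNIV. sphere_avg (\<lambda>z. sphere_point z $ i) (g i) q)
        + snd q * (\<Sum>i\<in>UNIV. \<Sum>j\<in>UNIV. sphere_avg (\<lambda>z. sphere_point z $ i * sphere_point z $ j) (h i j) q))"
        by (simp add: sum.distrib distrib_left sum_distrib_left[symmetric] mult.left_commute[of _ "snd q"])
    qed
    show "continuous_on UNIV (\<lambda>q. snd q * sphere_avg (\<lambda>_. 1) (h i j) q)"
      "continuous_on UNIV (\<lambda>q. sphere_avg (\<lambda>_. 1) (g i) q + snd q * (\<Sum>j\<in>UNIV. sphere_avg (\<lambda>z. sphere_point z $ j) (h i j) q))"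
      "continuous_on UNIV (\<lambda>q. 2 * (\<Sum>i\<in>UNIV. sphere_avg (\<lambda>z. sphere_point z $ i) (g i) q)
        + snd q * (\<Sum>i\<in>UNIV. \<Sum>j\<in>UNIV. sphere_avg (\<lambda>z. sphere_point z $ i * sphere_point z $ j) (h i j) q))"
      by (intro continuous_intros sphere_avg_continuous gc h)+
    show "2 * (\<Sum>i\<in>UNIV. sphere_avg (\<lambda>z. sphere_point z $ i) (g i) q)
        + snd q * (\<Sum>i\<in>UNIV. \<Sum>j\<in>UNIV. sphere_avg (\<lambda>z. sphere_point z $ i * sphere_point z $ j) (h i j) q)
        = (\<Sum>i\<in>UNIV. snd q * sphere_avg (\<lambda>_. 1) (h i i) q)"
      using sphere_avg_laplacian[OF g h, where t="snd q" and y="fst q"] by (simp add: sum_distrib_left)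
  qed
qed

section \<open>Integration over the cube\<close>

lemma UNIV_3_shift: "(UNIV :: 3 set) = {i, i + 1, i + 2}"
  and shift_3_neq [simp]: "i + 1 \<noteq> i" "i + 2 \<noteq> i" "i + 2 \<noteq> i + 1" "i \<noteq> i + 1" "i \<noteq> i + 2" "i + 1 \<noteq> i + 2" for i :: 3
proof -
  have ne: "(1::3) \<noteq> 0" "(2::3) \<noteq> 0" "(2::3) \<noteq> 1" by auto
  then show "i + 1 \<noteq> i" "i + 2 \<noteq> i" "i + 2 \<noteq> i + 1" "i \<noteq> i + 1" "i \<noteq> i + 2" "i + 1 \<noteq> i + 2"
    by auto
  then have "card {i, i + 1, i + 2} = CARD(3)" by simp
  then show "(UNIV :: 3 set) = {i, i + 1, i + 2}"
    by (metis card_subset_eq finite_class.finite_UNIV subset_UNIV)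
qed

lemma sum_3_shift: "(\<Sum>k\<in>UNIV. F k) = F i + F (i + 1) + F (i + 2)" for i :: 3 and F :: "3 \<Rightarrow> 'a::comm_monoid_add"
  by (subst UNIV_3_shift[of i]) (simp add: add.assoc)

lemma prod_3_shift: "(\<Prod>k\<in>UNIV. F k) = F i * F (i + 1) * F (i + 2)" for i :: 3 and F :: "3 \<Rightarrow> 'a::comm_monoid_mult"
  by (subst UNIV_3_shift[of i]) (simp add: mult.assoc)

lemma all_3_shift: "(\<forall>k. P k) \<longleftrightarrow> P i \<and> P (i + 1) \<and> P (i + 2)" for i :: 3
  using UNIV_3_shift[of i] by (metis UNIV_I empty_iff insert_iff)

lemma plane_point_nth [simp]:
  "plane_point i c z $ i = c" "plane_point i c z $ (i + 1) = fst z" "plane_point i c z $ (i + 2) = snd z"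
  by (simp_all add: plane_point_def)

lemma plane_point_add: "plane_point i c z = plane_point i 0 z + c *\<^sub>R axis i 1"
  by (auto simp: vec_eq_iff plane_point_def axis_def)

lemma continuous_on_vec_nthI:
  assumes "\<And>i. continuous_on S (\<lambda>x. f x $ i)"
  shows "continuous_on S (f :: _ \<Rightarrow> real^'n)"
  using continuous_on_vec_lambda[of S "\<lambda>i x. f x $ i"] assms by simp

lemma continuous_on_plane_point [continuous_intros]:
  assumes "continuous_on S c" "continuous_on S z"
  shows "continuous_on S (\<lambda>x. plane_point i (c x) (z x))"
proof (rule continuous_on_vec_nthI)
  fix k show "continuous_on S (\<lambda>x. plane_point i (c x) (z x) $ k)"
    using assms by (cases "k = i"; cases "k = i + 1") (auto simp: plane_point_def intro!: continuous_intros)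
qed

text \<open>The map only permutes coordinates, so preimages of boxes are boxes of the same volume.
  It prepares Fubini's theorem with integration along axis i on the inside.\<close>

lemma lborel_plane_point: "distr lborel borel (\<lambda>p. plane_point i (fst p) (snd p)) = lborel"
proof (rule lborel_eqI[symmetric])
  have m: "(\<lambda>p. plane_point i (fst p) (snd p)) \<in> measurable borel borel"
    by (intro borel_measurable_continuous_onI continuous_intros)
  have all: "(\<forall>b\<in>Basis. P b) \<longleftrightarrow> (\<forall>k::3. P (axis k 1))" for P :: "real^3 \<Rightarrow> bool"
    by (auto simp: Basis_vec_def)
  fix l u :: "real^3" assume "\<And>b. b \<in> Basis \<Longrightarrow> l \<bullet> b \<le> u \<bullet> b"
  then have le: "l $ k \<le> u $ k" for k
    by (metis axis_in_Basis_iff inner_axis' inner_commute mult.left_neutral Basis_real_def inner_real_def singletonI)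
  have bij: "(Basis :: (real^3) set) = (\<lambda>k. axis k 1) ` UNIV"
    by (auto simp: Basis_vec_def)
  have inj: "inj (\<lambda>k::3. axis k (1::real))" by (auto simp: inj_def axis_eq_axis)
  have "(\<lambda>p. plane_point i (fst p) (snd p)) -` box l u =
      box (l $ i, l $ (i + 1), l $ (i + 2)) (u $ i, u $ (i + 1), u $ (i + 2))"
    by (auto simp: mem_box_cart all_3_shift[of _ i] mem_box Basis_prod_def inner_Pair)
  then have "emeasure (distr lborel borel (\<lambda>p. plane_point i (fst p) (snd p))) (box l u) =
     emeasure lborel (box (l $ i, l $ (i + 1), l $ (i + 2)) (u $ i, u $ (i + 1), u $ (i + 2)))"
    using m by (simp add: emeasure_distr)
  also have "\<dots> = ennreal ((u $ i - l $ i) * ((u $ (i + 1) - l $ (i + 1)) * (u $ (i + 2) - l $ (i + 2))))"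
    using le by (subst emeasure_lborel_box)
      (auto simp: Basis_prod_def prod.union_disjoint image_iff inner_Pair)
  also have "\<dots> = ennreal (\<Prod>k\<in>UNIV. u $ k - l $ k)"
    by (simp add: prod_3_shift[of _ i] mult.assoc)
  also have "(\<Prod>k\<in>UNIV. u $ k - l $ k) = (\<Prod>b\<in>Basis. (u - l) \<bullet> b)"
    unfolding bij by (subst prod.reindex[OF inj]) (simp add: inner_axis)
  finally show "emeasure (distr lborel borel (\<lambda>p. plane_point i (fst p) (snd p))) (box l u) =
    ennreal (\<Prod>b\<in>Basis. (u - l) \<bullet> b)" .
qed simp

definition closed_cube :: "real \<Rightarrow> (real^3) set" where
  "closed_cube a = cbox (\<chi> i. - a) (\<chi> i. a)"

definition square :: "real \<Rightarrow> (real \<times> real) set" where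
  "square a = cbox (- a, - a) (a, a)"

lemma mem_closed_cube: "y \<in> closed_cube a \<longleftrightarrow> (\<forall>i. - a \<le> y $ i \<and> y $ i \<le> a)"
  by (simp add: closed_cube_def mem_box_cart)

lemma mem_square: "z \<in> square a \<longleftrightarrow> - a \<le> fst z \<and> fst z \<le> a \<and> - a \<le> snd z \<and> snd z \<le> a"
  by (cases z) (auto simp: square_def cbox_Pair_eq)

lemma plane_point_in_closed_cube:
  "plane_point i c z \<in> closed_cube a \<longleftrightarrow> - a \<le> c \<and> c \<le> a \<and> z \<in> square a"
  by (auto simp: mem_closed_cube mem_square all_3_shift[of _ i])

lemma set_integrable_bounded:
  fixes D :: "'a::euclidean_space \<Rightarrow> real"
  assumes "D \<in> borel_measurable borel" "compact S" "\<And>y. y \<in> S \<Longrightarrow> \<bar>D y\<bar> \<le> B"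
  shows "set_integrable lborel S D"
  unfolding set_integrable_def
proof (rule integrableI_bounded_set[where A=S and B=B])
  show "emeasure lborel S < \<infinity>" using assms(2) by (intro emeasure_bounded_finite compact_imp_bounded)
  show "(\<lambda>x. indicator S x *\<^sub>R D x) \<in> borel_measurable lborel"
    using assms(1,2) by (auto intro!: borel_measurable_times borel_measurable_indicator borel_compact)
qed (use assms in \<open>auto simp: compact_imp_closed\<close>)

lemma set_integrable_continuous:
  fixes f :: "'a::euclidean_space \<Rightarrow> real"
  shows "compact S \<Longrightarrow> continuous_on S f \<Longrightarrow> set_integrable lborel S f"
  unfolding set_integrable_def by (rule borel_integrable_compact)

lemma integral_cube_partial_derivative:
  fixes D U :: "real^3 \<Rightarrow> real"
  assumes a: "a > 0"
    and D: "D \<in> borel_measurable borel" "\<And>y. y \<in> closed_cube a \<Longrightarrow> \<bar>D y\<bar> \<le> B"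
    and U: "continuous_on UNIV U"
    and der: "\<And>z. \<exists>S. finite S \<and> (\<forall>c. c \<notin> S \<longrightarrow>
       ((\<lambda>s. U (plane_point i s z)) has_real_derivative D (plane_point i c z)) (at c))"
  shows "(LINT y:closed_cube a|lborel. D y) =
    integral (square a) (\<lambda>z. U (plane_point i a z)) - integral (square a) (\<lambda>z. U (plane_point i (- a) z))"
proof -
  have m: "(\<lambda>p. plane_point i (fst p) (snd p)) \<in> measurable borel borel"
    by (intro borel_measurable_continuous_onI continuous_intros)
  have int: "set_integrable lborel (closed_cube a) D"
    using D by (intro set_integrable_bounded) (auto simp: closed_cube_def)
  define F where "F y = indicator (closed_cube a) y * D y" for y
  have Fm: "F \<in> borel_measurable borel"
    unfolding F_def using D(1) by (intro borel_measurable_times borel_measurable_indicator) (auto simp: closed_cube_def)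
  have Fi: "integrable lborel F"
    using int by (simp add: set_integrable_def F_def[abs_def])
  have Fi2: "integrable (lborel \<Otimes>\<^sub>M lborel) (\<lambda>(c, z). F (plane_point i c z))"
  proof -
    have "integrable (distr lborel borel (\<lambda>p. plane_point i (fst p) (snd p))) F"
      using Fi by (simp add: lborel_plane_point)
    then show ?thesis
      using m by (subst (asm) integrable_distr_eq) (auto simp: Fm lborel_prod case_prod_unfold)
  qed
  have "(LINT y:closed_cube a|lborel. D y) = integral\<^sup>L lborel F"
    by (simp add: set_lebesgue_integral_def F_def[abs_def])
  also have "\<dots> = integral\<^sup>L lborel (\<lambda>p. F (plane_point i (fst p) (snd p)))"
    by (subst lborel_plane_point[of i, symmetric], subst integral_distr) (use m Fm in auto)
  also have "\<dots> = (\<integral>z. (\<integral>c. F (plane_point i c z) \<partial>lborel) \<partial>lborel)"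
    using lborel_pair.integral_snd[OF Fi2] by (simp add: lborel_prod case_prod_unfold)
  also have "\<dots> = (LINT z:square a|lborel. U (plane_point i a z) - U (plane_point i (- a) z))"
    unfolding set_lebesgue_integral_def
  proof (rule Bochner_Integration.integral_cong[OF refl])
    fix z
    show "(\<integral>c. F (plane_point i c z) \<partial>lborel) =
       indicator (square a) z *\<^sub>R (U (plane_point i a z) - U (plane_point i (- a) z))"
    proof (cases "z \<in> square a")
      case True
      have "(\<lambda>c. D (plane_point i c z)) \<in> borel_measurable borel"
        by (rule measurable_compose[OF _ D(1)])
          (intro borel_measurable_continuous_onI continuous_intros)
      then have si: "set_integrable lborel {- a..a} (\<lambda>c. D (plane_point i c z))"
        using D(2) True by (intro set_integrable_bounded[where B=B]) (auto simp: plane_point_in_closed_cube)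
      obtain S where S: "finite S" "\<And>c. c \<notin> S \<Longrightarrow>
          ((\<lambda>s. U (plane_point i s z)) has_real_derivative D (plane_point i c z)) (at c)"
        using der by blast
      have "((\<lambda>c. D (plane_point i c z)) has_integral U (plane_point i a z) - U (plane_point i (- a) z)) {- a..a}"
        by (rule fundamental_theorem_of_calculus_strong[OF S(1)])
          (use a S in \<open>auto simp: has_real_derivative_iff_has_vector_derivative[symmetric]
             intro!: continuous_intros continuous_on_compose2[OF U]\<close>)
      moreover have "(\<integral>c. F (plane_point i c z) \<partial>lborel) = (LINT c:{- a..a}|lborel. D (plane_point i c z))"
        unfolding set_lebesgue_integral_def F_def using True
        by (intro Bochner_Integration.integral_cong) (auto simp: plane_point_in_closed_cube indicator_def)
      ultimately show ?thesis
        using set_borel_integral_eq_integral(2)[OF si] True by (simp add: integral_unique)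
    qed (simp add: F_def plane_point_in_closed_cube)
  qed
  also have "\<dots> = integral (square a) (\<lambda>z. U (plane_point i a z) - U (plane_point i (- a) z))"
    by (intro set_borel_integral_eq_integral set_integrable_continuous)
      (auto simp: square_def intro!: continuous_intros continuous_on_compose2[OF U])
  also have "\<dots> = integral (square a) (\<lambda>z. U (plane_point i a z)) - integral (square a) (\<lambda>z. U (plane_point i (- a) z))"
    unfolding square_def
    by (intro Henstock_Kurzweil_Integration.integral_diff integrable_continuous continuous_on_compose2[OF U] continuous_intros) auto
  finally show ?thesis .
qed

section \<open>Kirchhoff's formula in the cube\<close>

lemma plane_point_has_derivative:
  "((\<lambda>s. plane_point i s u) has_derivative (\<lambda>d. d *\<^sub>R axis i 1)) (at c)"
proof -
  have "((\<lambda>s. plane_point i 0 u + s *\<^sub>R axis i 1) has_derivative (\<lambda>d. d *\<^sub>R axis i 1)) (at c)"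
    by (auto intro!: derivative_eq_intros)
  then show ?thesis by (simp add: plane_point_add[symmetric])
qed

lemma sum_squares_norm: "(\<Sum>i\<in>UNIV. ((y::real^'n) $ i)\<^sup>2) = (norm y)\<^sup>2"
  by (simp add: norm_vec_def L2_set_def sum_nonneg)

context C2_wave
begin

lemma v_cont: "continuous_on UNIV v" and vx_cont: "continuous_on UNIV (vx i)"
  and vt_cont: "continuous_on UNIV vt"
  using v_der vx_der vt_der by (meson continuous_at_imp_continuous_on has_derivative_continuous)+

definition light_cone :: "real^3 \<Rightarrow> real^3 \<Rightarrow> (real^3) \<times> real" where
  "light_cone z = (\<lambda>y. (y, norm (y - z)))"

text \<open>The field in Kirchhoff's formula, with the advanced time \<open>\<bar>y - z\<bar>\<close>, multiplied by
  \<open>\<bar>y - z\<bar>\<^sup>3\<close> to remove the singularity. By the wave equation, the second derivatives cancel in its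
  divergence.\<close>

definition kirchhoff :: "real^3 \<Rightarrow> 3 \<Rightarrow> real^3 \<Rightarrow> real" where
  "kirchhoff z i y = (norm (y - z))\<^sup>2 * vx i (light_cone z y) + (y - z) $ i * v (light_cone z y)
     - norm (y - z) * (y - z) $ i * vt (light_cone z y)"

definition kirchhoff_deriv :: "real^3 \<Rightarrow> 3 \<Rightarrow> real^3 \<Rightarrow> real" where
  "kirchhoff_deriv z i y = 3 * (y - z) $ i * vx i (light_cone z y) + (norm (y - z))\<^sup>2 * vxx i i (light_cone z y)
     + v (light_cone z y) - norm (y - z) * vt (light_cone z y) - ((y - z) $ i)\<^sup>2 * vtt (light_cone z y)"

text \<open>One third of the divergence of \<open>kirchhoff\<close>, and at the same time its inner
  product with y - z, divided by the squared distance. This coincidence makes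
  \<open>kirchhoff\<close> divided by the cubed distance divergence free away from z. At y = z the
  value is v (z, 0).\<close>

definition kirchhoff_source :: "real^3 \<Rightarrow> real^3 \<Rightarrow> real" where
  "kirchhoff_source z y = (\<Sum>i\<in>UNIV. (y - z) $ i * vx i (light_cone z y)) + v (light_cone z y) - norm (y - z) * vt (light_cone z y)"

lemma sum_kirchhoff_deriv: "(\<Sum>i\<in>UNIV. kirchhoff_deriv z i y) = 3 * kirchhoff_source z y"
proof -
  have "(\<Sum>i\<in>UNIV. kirchhoff_deriv z i y) = 3 * (\<Sum>i\<in>UNIV. (y - z) $ i * vx i (light_cone z y))
     + (norm (y - z))\<^sup>2 * (\<Sum>i\<in>UNIV. vxx i i (light_cone z y)) + 3 * v (light_cone z y) - 3 * norm (y - z) * vt (light_cone z y)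
     - (\<Sum>i\<in>UNIV. ((y - z) $ i)\<^sup>2) * vtt (light_cone z y)"
    by (simp add: kirchhoff_deriv_def sum.distrib sum_subtractf sum_distrib_left sum_distrib_right algebra_simps)
  then show ?thesis
    by (simp only: sum_squares_norm wave kirchhoff_source_def) (simp add: algebra_simps)
qed

lemma sum_kirchhoff: "(\<Sum>i\<in>UNIV. kirchhoff z i y * (y - z) $ i) = (norm (y - z))\<^sup>2 * kirchhoff_source z y"
proof -
  have "(\<Sum>i\<in>UNIV. kirchhoff z i y * (y - z) $ i) =
      (norm (y - z))\<^sup>2 * (\<Sum>i\<in>UNIV. (y - z) $ i * vx i (light_cone z y)) +
      (\<Sum>i\<in>UNIV. ((y - z) $ i)\<^sup>2) * (v (light_cone z y) - norm (y - z) * vt (light_cone z y))"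
    by (simp add: kirchhoff_def sum.distrib sum_subtractf sum_distrib_left sum_distrib_right
        power2_eq_square algebra_simps)
  then show ?thesis
    by (simp only: sum_squares_norm kirchhoff_source_def) (simp add: algebra_simps)
qed

lemma continuous_on_light_cone: "continuous_on S (light_cone z)"
  unfolding light_cone_def by (intro continuous_intros)

lemma continuous_on_kirchhoff: "continuous_on S (kirchhoff z i)"
  and continuous_on_kirchhoff_deriv: "continuous_on S (kirchhoff_deriv z i)"
  and continuous_on_kirchhoff_source: "continuous_on S (kirchhoff_source z)"
proof -
  note c = continuous_on_compose2[OF _ continuous_on_light_cone subset_UNIV]
  show "continuous_on S (kirchhoff z i)" "continuous_on S (kirchhoff_deriv z i)" "continuous_on S (kirchhoff_source z)"
    unfolding kirchhoff_def kirchhoff_deriv_def kirchhoff_source_def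
    by (intro continuous_intros c[OF v_cont] c[OF vx_cont] c[OF vt_cont] c[OF vxx_cont] c[OF vtt_cont])+
qed

lemma norm_along_plane_point:
  assumes "norm (plane_point i c u - z) \<noteq> 0"
  shows "((\<lambda>s. norm (plane_point i s u - z)) has_real_derivative (c - z $ i) / norm (plane_point i c u - z)) (at c)"
proof -
  have "((\<lambda>s. plane_point i s u - z) has_derivative (\<lambda>d. d *\<^sub>R axis i 1)) (at c)"
    by (auto intro!: derivative_eq_intros plane_point_has_derivative)
  moreover have "plane_point i c u - z \<noteq> 0" using assms by simp
  ultimately have "((\<lambda>s. norm (plane_point i s u - z)) has_derivative
      (\<lambda>d. (d *\<^sub>R axis i 1) \<bullet> sgn (plane_point i c u - z))) (at c)"
    by (intro has_derivative_compose[OF _ has_derivative_norm])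
  moreover have "axis i 1 \<bullet> sgn (plane_point i c u - z) = (c - z $ i) / norm (plane_point i c u - z)"
    by (simp add: sgn_div_norm inner_axis' divide_inverse mult.commute)
  ultimately show ?thesis
    unfolding has_field_derivative_def
    by (elim has_derivative_eq_rhs) (simp add: fun_eq_iff)
qed

lemma DERIV_along_light_cone:
  assumes \<phi>: "(\<phi> has_derivative (\<lambda>d. (\<Sum>j\<in>UNIV. fst d $ j * G j) + snd d * K)) (at (light_cone z (plane_point i c u)))"
    and nz: "norm (plane_point i c u - z) \<noteq> 0"
  shows "((\<lambda>s. \<phi> (light_cone z (plane_point i s u))) has_real_derivative
     G i + (c - z $ i) / norm (plane_point i c u - z) * K) (at c)"
proof -
  have "((\<lambda>s. plane_point i s u) has_derivative (\<lambda>d. d *\<^sub>R axis i 1)) (at c)"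
    by (rule plane_point_has_derivative)
  from has_derivative_Pair[OF this norm_along_plane_point[OF nz, unfolded has_field_derivative_def]]
  have "((\<lambda>s. light_cone z (plane_point i s u)) has_derivative
      (\<lambda>d. (d *\<^sub>R axis i 1, (c - z $ i) / norm (plane_point i c u - z) * d))) (at c)"
    unfolding light_cone_def .
  from has_derivative_compose[OF this \<phi>] show ?thesis
    unfolding has_field_derivative_def
    by (rule has_derivative_eq_rhs)
      (simp add: fun_eq_iff axis_def if_distrib[of "\<lambda>x. x * _"] if_distrib[of "\<lambda>x. _ * x"] algebra_simps cong: if_cong)
qed

text \<open>Moving y also moves the advanced time, which produces mixed derivatives
  \<open>vxt\<close> from both \<open>vx\<close> and \<open>vt\<close>; they cancel already within a
  single component. The point z is excluded because the norm is not differentiable at 0.\<close>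

lemma kirchhoff_has_derivative:
  assumes nz: "norm (plane_point i c u - z) \<noteq> 0"
  shows "((\<lambda>s. kirchhoff z i (plane_point i s u)) has_real_derivative kirchhoff_deriv z i (plane_point i c u)) (at c)"
proof -
  define r where "r = norm (plane_point i c u - z)"
  have r: "r \<noteq> 0" using nz by (simp add: r_def)
  note d = norm_along_plane_point[OF nz] DERIV_along_light_cone[OF v_der nz] DERIV_along_light_cone[OF vx_der nz]
    DERIV_along_light_cone[OF vt_der nz]
  show ?thesis
    unfolding kirchhoff_def kirchhoff_deriv_def vector_minus_component plane_point_nth
    apply (rule derivative_eq_intros d refl)+
    apply (fold r_def)
    using r by (simp add: field_simps power2_eq_square)
qed

text \<open>Freezing the radius at \<epsilon> in the denominator removes the singularity at z and
  leaves only a kink on the sphere of radius \<epsilon>. Gauss's theorem then applies on the whole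
  cube, without cutting out a ball and integrating over its boundary.\<close>

definition reg_kirchhoff :: "real \<Rightarrow> real^3 \<Rightarrow> 3 \<Rightarrow> real^3 \<Rightarrow> real" where
  "reg_kirchhoff \<epsilon> z i y = kirchhoff z i y / max (norm (y - z)) \<epsilon> ^ 3"

definition reg_kirchhoff_deriv :: "real \<Rightarrow> real^3 \<Rightarrow> 3 \<Rightarrow> real^3 \<Rightarrow> real" where
  "reg_kirchhoff_deriv \<epsilon> z i y = kirchhoff_deriv z i y / max (norm (y - z)) \<epsilon> ^ 3
     - (if norm (y - z) < \<epsilon> then 0 else 3 * kirchhoff z i y * (y - z) $ i / norm (y - z) ^ 5)"

lemma continuous_on_reg_kirchhoff:
  assumes "\<epsilon> > 0" shows "continuous_on S (reg_kirchhoff \<epsilon> z i)"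
proof -
  have "max (norm (y - z)) \<epsilon> \<noteq> 0" for y using assms by linarith
  then show ?thesis unfolding reg_kirchhoff_def
    by (intro continuous_intros continuous_on_kirchhoff) simp
qed

lemma reg_kirchhoff_has_derivative:
  assumes \<epsilon>: "\<epsilon> > 0" and nz: "norm (plane_point i c u - z) \<noteq> 0" and ne: "norm (plane_point i c u - z) \<noteq> \<epsilon>"
  shows "((\<lambda>s. reg_kirchhoff \<epsilon> z i (plane_point i s u)) has_real_derivative
    reg_kirchhoff_deriv \<epsilon> z i (plane_point i c u)) (at c)"
proof -
  define R where "R s = norm (plane_point i s u - z)" for s
  note d = norm_along_plane_point[OF nz, folded R_def] kirchhoff_has_derivative[OF nz]
  have Rc: "continuous_on UNIV R" unfolding R_def by (intro continuous_intros)
  show ?thesis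
  proof (cases "R c < \<epsilon>")
    case True
    have o: "open {s. R s < \<epsilon>}" by (intro open_Collect_less Rc continuous_intros)
    have "((\<lambda>s. kirchhoff z i (plane_point i s u) / \<epsilon> ^ 3) has_real_derivative
        kirchhoff_deriv z i (plane_point i c u) / \<epsilon> ^ 3) (at c)"
      by (intro DERIV_cdivide d)
    moreover have "kirchhoff_deriv z i (plane_point i c u) / \<epsilon> ^ 3 = reg_kirchhoff_deriv \<epsilon> z i (plane_point i c u)"
      using True by (simp add: reg_kirchhoff_deriv_def R_def max_absorb2)
    ultimately show ?thesis
      using has_field_derivative_transform_within_open[OF _ o] True
      by (auto simp: reg_kirchhoff_def R_def max_absorb2)
  next
    case False
    then have gt: "\<epsilon> < R c" using ne by (simp add: R_def)
    have o: "open {s. \<epsilon> < R s}" by (intro open_Collect_less Rc continuous_intros)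
    have R0: "R c > 0" using gt \<epsilon> by linarith
    have "((\<lambda>s. kirchhoff z i (plane_point i s u) / R s ^ 3) has_real_derivative
        (kirchhoff_deriv z i (plane_point i c u) * R c ^ 3
          - kirchhoff z i (plane_point i c u) * (3 * (((c - z $ i) / R c) * R c ^ 2))) / (R c ^ 3 * R c ^ 3)) (at c)"
      using R0 by (intro DERIV_divide d DERIV_power[where n=3, simplified, OF d(1)]) (auto intro!: derivative_eq_intros d)
    moreover have "(kirchhoff_deriv z i (plane_point i c u) * R c ^ 3
          - kirchhoff z i (plane_point i c u) * (3 * (((c - z $ i) / R c) * R c ^ 2))) / (R c ^ 3 * R c ^ 3)
       = reg_kirchhoff_deriv \<epsilon> z i (plane_point i c u)"
      using gt R0 by (simp add: reg_kirchhoff_deriv_def R_def[symmetric] max_absorb1)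
        (simp add: field_simps eval_nat_numeral)
    ultimately show ?thesis
      using has_field_derivative_transform_within_open[OF _ o] gt
      by (auto simp: reg_kirchhoff_def R_def max_absorb1)
  qed
qed

text \<open>With r the distance from z, the quotient rule outside the ball gives
  \<open>kirchhoff_source\<close> times 3 / r^3 - 3 r^2 / r^5, which is 0. Inside, the denominator
  is the constant \<epsilon>^3.\<close>

lemma sum_reg_kirchhoff_deriv:
  assumes "\<epsilon> > 0"
  shows "(\<Sum>i\<in>UNIV. reg_kirchhoff_deriv \<epsilon> z i y) = indicator (ball z \<epsilon>) y * (3 / \<epsilon> ^ 3 * kirchhoff_source z y)"
proof (cases "norm (y - z) < \<epsilon>")
  case True
  then have "(\<Sum>i\<in>UNIV. reg_kirchhoff_deriv \<epsilon> z i y) = (\<Sum>i\<in>UNIV. kirchhoff_deriv z i y) / \<epsilon> ^ 3"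
    by (simp add: reg_kirchhoff_deriv_def max_absorb2 sum_divide_distrib)
  moreover have "y \<in> ball z \<epsilon>" using True by (simp add: dist_norm norm_minus_commute)
  ultimately show ?thesis by (simp add: sum_kirchhoff_deriv)
next
  case False
  then have "(\<Sum>i\<in>UNIV. reg_kirchhoff_deriv \<epsilon> z i y) = (\<Sum>i\<in>UNIV. kirchhoff_deriv z i y) / norm (y - z) ^ 3
     - 3 * (\<Sum>i\<in>UNIV. kirchhoff z i y * (y - z) $ i) / norm (y - z) ^ 5"
    by (simp add: reg_kirchhoff_deriv_def max_absorb1 sum_divide_distrib sum_subtractf sum_distrib_left mult.assoc)
  also have "\<dots> = 0"
    unfolding sum_kirchhoff_deriv sum_kirchhoff using False assms
    by (auto simp: divide_simps eval_nat_numeral)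
  moreover have "y \<notin> ball z \<epsilon>" using False by (simp add: dist_norm norm_minus_commute)
  ultimately show ?thesis by simp
qed

end

section \<open>The divergence theorem for the regularised field\<close>

lemma abs_le_on_closed_cube:
  fixes F :: "real^3 \<Rightarrow> real"
  assumes "continuous_on (closed_cube a) F"
  obtains B where "\<And>y. y \<in> closed_cube a \<Longrightarrow> \<bar>F y\<bar> \<le> B"
proof -
  have "compact (F ` closed_cube a)"
    using assms by (intro compact_continuous_image) (auto simp: closed_cube_def)
  then show thesis
    using that by (metis bounded_real compact_imp_bounded imageI)
qed

lemma finite_square_eq: "finite {s. (s - b)\<^sup>2 = (k::real)}"
proof (rule finite_subset)
  show "{s. (s - b)\<^sup>2 = k} \<subseteq> {b + sqrt k, b - sqrt k}"
  proof
    fix s assume "s \<in> {s. (s - b)\<^sup>2 = k}"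
    then have "sqrt k = \<bar>s - b\<bar>" by auto
    then show "s \<in> {b + sqrt k, b - sqrt k}" by (auto simp: abs_if)
  qed
qed simp

lemma norm_plane_point_diff:
  "(norm (plane_point i c u - z))\<^sup>2 = (c - z $ i)\<^sup>2 + (fst u - z $ (i + 1))\<^sup>2 + (snd u - z $ (i + 2))\<^sup>2"
  by (simp add: sum_squares_norm[symmetric] sum_3_shift[of _ i])

text \<open>A line meets a sphere in finitely many points. For the radii 0 and \<epsilon> these are
  the exceptional points on the lines of integration.\<close>

lemma finite_norm_plane_point_eq: "finite {c. norm (plane_point i c u - z) = R}"
proof (rule finite_subset[OF _ finite_square_eq])
  show "{c. norm (plane_point i c u - z) = R} \<subseteq>
    {s. (s - z $ i)\<^sup>2 = R\<^sup>2 - (fst u - z $ (i + 1))\<^sup>2 - (snd u - z $ (i + 2))\<^sup>2}"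
    using norm_plane_point_diff[of i _ u z] by auto
qed

context C2_wave
begin

definition kirchhoff_flux :: "real \<Rightarrow> real^3 \<Rightarrow> real" where
  "kirchhoff_flux a z = (\<Sum>i\<in>UNIV. \<Sum>\<sigma>\<in>{1, -1}. \<sigma> * integral (square a)
     (\<lambda>u. kirchhoff z i (plane_point i (\<sigma> * a) u) / norm (plane_point i (\<sigma> * a) u - z) ^ 3))"

text \<open>By \<open>far\<close> the faces avoid the open ball of radius \<epsilon>, so on them the
  regularised and the original field agree, and the flux can be computed with any such
  \<epsilon>.\<close>

lemma kirchhoff_flux_eq:
  assumes a: "a > 0" and \<epsilon>: "\<epsilon> > 0"
    and far: "\<And>i \<sigma> u. \<sigma> \<in> {1, -1} \<Longrightarrow> u \<in> square a \<Longrightarrow> \<epsilon> \<le> norm (plane_point i (\<sigma> * a) u - z)"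
  shows "kirchhoff_flux a z =
    (LINT y:closed_cube a|lborel. indicator (ball z \<epsilon>) y * (3 / \<epsilon> ^ 3 * kirchhoff_source z y))"
proof -
  let ?D = "reg_kirchhoff_deriv \<epsilon> z"
  have Dm: "?D i \<in> borel_measurable borel" for i
  proof -
    have [measurable]: "kirchhoff_deriv z i \<in> borel_measurable borel" "kirchhoff z i \<in> borel_measurable borel"
      "(\<lambda>y. y $ i) \<in> borel_measurable (borel :: (real^3) measure)"
      by (intro borel_measurable_continuous_onI continuous_on_kirchhoff_deriv continuous_on_kirchhoff continuous_intros)+
    show ?thesis unfolding reg_kirchhoff_deriv_def vector_minus_component by measurable
  qed
  have Db: "\<exists>B. \<forall>y\<in>closed_cube a. \<bar>?D i y\<bar> \<le> B" for i
  proof -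
    have m: "max (norm (y - z)) \<epsilon> \<noteq> 0" for y using \<epsilon> by linarith
    obtain B1 where B1: "\<And>y. y \<in> closed_cube a \<Longrightarrow> \<bar>kirchhoff_deriv z i y / max (norm (y - z)) \<epsilon> ^ 3\<bar> \<le> B1"
      by (rule abs_le_on_closed_cube[of a "\<lambda>y. kirchhoff_deriv z i y / max (norm (y - z)) \<epsilon> ^ 3"])
        (use m in \<open>auto intro!: continuous_intros continuous_on_kirchhoff_deriv\<close>)
    \<comment> \<open>The second part of the derivative is present only at distance at least
      \<epsilon> from z, so its fifth power in the denominator may be replaced by \<epsilon>^5,
      which gives a continuous majorant.\<close>
    obtain B2 where B2: "\<And>y. y \<in> closed_cube a \<Longrightarrow> \<bar>3 * kirchhoff z i y * (y - z) $ i / \<epsilon> ^ 5\<bar> \<le> B2"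
      by (rule abs_le_on_closed_cube[of a "\<lambda>y. 3 * kirchhoff z i y * (y - z) $ i / \<epsilon> ^ 5"])
        (use \<epsilon> in \<open>auto intro!: continuous_intros continuous_on_kirchhoff\<close>)
    have "\<bar>if norm (y - z) < \<epsilon> then 0 else 3 * kirchhoff z i y * (y - z) $ i / norm (y - z) ^ 5\<bar> \<le> B2"
      if "y \<in> closed_cube a" for y
    proof (cases "norm (y - z) < \<epsilon>")
      case True then show ?thesis using order_trans[OF abs_ge_zero B2[OF that]] by simp
    next
      case False
      then have "\<bar>3 * kirchhoff z i y * (y - z) $ i\<bar> / norm (y - z) ^ 5 \<le> \<bar>3 * kirchhoff z i y * (y - z) $ i\<bar> / \<epsilon> ^ 5"
        using \<epsilon> by (intro divide_left_mono power_mono mult_pos_pos zero_less_power) auto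
      also have "\<dots> \<le> B2" using B2[OF that] \<epsilon> by (simp add: abs_divide)
      finally show ?thesis using False by (simp add: abs_divide)
    qed
    then have "\<bar>?D i y\<bar> \<le> B1 + B2" if "y \<in> closed_cube a" for y
      unfolding reg_kirchhoff_deriv_def using B1[OF that] that by (smt (verit, best))
    then show ?thesis by blast
  qed
  have part: "(LINT y:closed_cube a|lborel. ?D i y) = (\<Sum>\<sigma>\<in>{1, -1}. \<sigma> * integral (square a)
     (\<lambda>u. kirchhoff z i (plane_point i (\<sigma> * a) u) / norm (plane_point i (\<sigma> * a) u - z) ^ 3))" for i
  proof -
    obtain B where B: "\<And>y. y \<in> closed_cube a \<Longrightarrow> \<bar>?D i y\<bar> \<le> B" using Db by blast
    have "(LINT y:closed_cube a|lborel. ?D i y) = integral (square a) (\<lambda>u. reg_kirchhoff \<epsilon> z i (plane_point i a u))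
        - integral (square a) (\<lambda>u. reg_kirchhoff \<epsilon> z i (plane_point i (- a) u))"
    proof (rule integral_cube_partial_derivative[OF a Dm B continuous_on_reg_kirchhoff[OF \<epsilon>]])
      fix u
      show "\<exists>S. finite S \<and> (\<forall>c. c \<notin> S \<longrightarrow> ((\<lambda>s. reg_kirchhoff \<epsilon> z i (plane_point i s u))
          has_real_derivative ?D i (plane_point i c u)) (at c))"
        using finite_norm_plane_point_eq[of i u z 0] finite_norm_plane_point_eq[of i u z \<epsilon>]
          reg_kirchhoff_has_derivative[OF \<epsilon>]
        by (intro exI[of _ "{c. norm (plane_point i c u - z) = 0} \<union> {c. norm (plane_point i c u - z) = \<epsilon>}"]) auto
    qed
    also have "integral (square a) (\<lambda>u. reg_kirchhoff \<epsilon> z i (plane_point i a u)) =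
        integral (square a) (\<lambda>u. kirchhoff z i (plane_point i a u) / norm (plane_point i a u - z) ^ 3)"
      by (intro integral_cong) (use far[of 1] in \<open>simp add: reg_kirchhoff_def max_absorb1\<close>)
    also have "integral (square a) (\<lambda>u. reg_kirchhoff \<epsilon> z i (plane_point i (- a) u)) =
        integral (square a) (\<lambda>u. kirchhoff z i (plane_point i (- a) u) / norm (plane_point i (- a) u - z) ^ 3)"
      by (intro integral_cong) (use far[of "-1"] in \<open>simp add: reg_kirchhoff_def max_absorb1\<close>)
    finally show ?thesis by simp
  qed
  have int: "integrable lborel (\<lambda>y. indicator (closed_cube a) y *\<^sub>R ?D i y)" for i
    using Db[of i] Dm by (fold set_integrable_def) (auto intro: set_integrable_bounded simp: closed_cube_def)
  have "kirchhoff_flux a z = (\<Sum>i\<in>UNIV. LINT y:closed_cube a|lborel. ?D i y)"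
    by (simp only: part kirchhoff_flux_def)
  also have "\<dots> = (LINT y:closed_cube a|lborel. (\<Sum>i\<in>UNIV. ?D i y))"
    unfolding set_lebesgue_integral_def scaleR_sum_right by (rule Bochner_Integration.integral_sum[symmetric]) (rule int)
  also have "\<dots> = (LINT y:closed_cube a|lborel. indicator (ball z \<epsilon>) y * (3 / \<epsilon> ^ 3 * kirchhoff_source z y))"
    by (simp only: sum_reg_kirchhoff_deriv[OF \<epsilon>])
  finally show ?thesis .
qed

text \<open>A small ball around z misses the cube, and the divergence of the regularised field is
  concentrated in that ball.\<close>

lemma kirchhoff_flux_outside:
  assumes a: "a > 0" and z: "z \<notin> closed_cube a"
  shows "kirchhoff_flux a z = 0"
proof -
  have "open (- closed_cube a)" by (simp add: closed_cube_def closed_cbox open_Compl)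
  then obtain \<epsilon> where \<epsilon>: "\<epsilon> > 0" "ball z \<epsilon> \<subseteq> - closed_cube a"
    using z open_contains_ball by blast
  have "kirchhoff_flux a z =
    (LINT y:closed_cube a|lborel. indicator (ball z \<epsilon>) y * (3 / \<epsilon> ^ 3 * kirchhoff_source z y))"
  proof (rule kirchhoff_flux_eq[OF a \<epsilon>(1)])
    fix i \<sigma> u assume "\<sigma> \<in> {1, -1::real}" "u \<in> square a"
    then have "plane_point i (\<sigma> * a) u \<in> closed_cube a"
      using a by (auto simp: plane_point_in_closed_cube)
    then have "plane_point i (\<sigma> * a) u \<notin> ball z \<epsilon>" using \<epsilon> by auto
    then show "\<epsilon> \<le> norm (plane_point i (\<sigma> * a) u - z)"
      by (simp add: dist_norm norm_minus_commute)
  qed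
  also have "\<dots> = (LINT y|(lborel :: (real^3) measure). 0)"
    unfolding set_lebesgue_integral_def
    by (rule Bochner_Integration.integral_cong) (use \<epsilon> in \<open>auto simp: indicator_def\<close>)
  finally show ?thesis by simp
qed

text \<open>The density 3 / \<epsilon>^3 times the volume of the ball is 4 pi, so the flux is 4 pi
  times the mean of the continuous function \<open>kirchhoff_source\<close> over an arbitrarily
  small ball around z.\<close>

lemma kirchhoff_flux_inside:
  assumes a: "a > 0" and z: "z \<in> open_cube a"
  shows "kirchhoff_flux a z = 4 * pi * v (z, 0)"
proof -
  have eq: "open_cube a = box (\<chi> i. - a) (\<chi> i. a)"
    by (auto simp: open_cube_def mem_box_cart)
  obtain \<epsilon>0 where \<epsilon>0: "\<epsilon>0 > 0" "ball z \<epsilon>0 \<subseteq> open_cube a"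
    using z open_contains_ball[of "open_cube a"] unfolding eq by (auto simp: open_box)
  have G: "continuous_on UNIV (kirchhoff_source z)" by (rule continuous_on_kirchhoff_source)
  have Gz: "kirchhoff_source z z = v (z, 0)" by (simp add: kirchhoff_source_def light_cone_def)
  have "\<bar>kirchhoff_flux a z - 4 * pi * v (z, 0)\<bar> \<le> e" if e: "e > 0" for e
  proof -
    \<comment> \<open>The total mass of the density is 4 pi, so this tolerance integrates to
      e.\<close>
    have "e / (4 * pi) > 0" using e by simp
    then obtain \<delta> where \<delta>: "\<delta> > 0" "\<And>y. dist y z < \<delta> \<Longrightarrow> \<bar>kirchhoff_source z y - v (z, 0)\<bar> < e / (4 * pi)"
      using G[unfolded continuous_on_iff, rule_format, of z] Gz by (auto simp: dist_real_def)
    define \<epsilon> where "\<epsilon> = min \<delta> \<epsilon>0"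
    have \<epsilon>: "\<epsilon> > 0" "\<epsilon> \<le> \<delta>" "ball z \<epsilon> \<subseteq> open_cube a"
      using \<delta>(1) \<epsilon>0 by (auto simp: \<epsilon>_def)
    have sub: "open_cube a \<subseteq> closed_cube a"
      by (auto simp: open_cube_def mem_closed_cube less_imp_le)
    let ?B = "ball z \<epsilon>"
    have vol: "measure lborel ?B = 4 / 3 * \<epsilon> ^ 3 * pi"
      using \<epsilon>(1) by (simp add: sphere_volume)
    have "kirchhoff_flux a z =
      (LINT y:closed_cube a|lborel. indicator ?B y * (3 / \<epsilon> ^ 3 * kirchhoff_source z y))"
    proof (rule kirchhoff_flux_eq[OF a \<epsilon>(1)])
      fix i \<sigma> u assume "\<sigma> \<in> {1, -1::real}" "u \<in> square a"
      then have "plane_point i (\<sigma> * a) u \<notin> open_cube a"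
        by (auto simp: open_cube_def all_3_shift[of _ i])
      then have "plane_point i (\<sigma> * a) u \<notin> ?B" using \<epsilon> by auto
      then show "\<epsilon> \<le> norm (plane_point i (\<sigma> * a) u - z)"
        by (simp add: dist_norm norm_minus_commute)
    qed
    also have "\<dots> = (LINT y:?B|lborel. 3 / \<epsilon> ^ 3 * kirchhoff_source z y)"
      unfolding set_lebesgue_integral_def
      by (rule Bochner_Integration.integral_cong) (use \<epsilon>(3) sub in \<open>auto simp: indicator_def\<close>)
    finally have 1: "kirchhoff_flux a z = (LINT y:?B|lborel. 3 / \<epsilon> ^ 3 * kirchhoff_source z y)" .
    have 2: "4 * pi * v (z, 0) = (LINT y:?B|lborel. 3 / \<epsilon> ^ 3 * v (z, 0))"
      using \<epsilon>(1) by (simp add: set_lebesgue_integral_def vol)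
    have i1: "set_integrable lborel ?B (\<lambda>y. 3 / \<epsilon> ^ 3 * kirchhoff_source z y)"
      by (rule set_integrable_subset[OF set_integrable_continuous[of "cball z \<epsilon>"]])
        (use \<epsilon>(1) in \<open>auto intro!: continuous_intros continuous_on_subset[OF G]\<close>)
    have i2: "set_integrable lborel ?B (\<lambda>y. 3 / \<epsilon> ^ 3 * v (z, 0))"
      by (rule set_integrable_subset[OF set_integrable_continuous[of "cball z \<epsilon>"]])
        (auto intro!: continuous_intros)
    have "\<bar>kirchhoff_flux a z - 4 * pi * v (z, 0)\<bar> =
       norm (LINT y:?B|lborel. 3 / \<epsilon> ^ 3 * kirchhoff_source z y - 3 / \<epsilon> ^ 3 * v (z, 0))"
      by (subst set_integral_diff(2)[OF i1 i2]) (simp add: 1 2)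
    also have "\<dots> \<le> (LINT y:?B|lborel. 3 / \<epsilon> ^ 3 * (e / (4 * pi)))"
      unfolding set_lebesgue_integral_def
    proof (rule Bochner_Integration.integral_norm_bound_integral)
      show "integrable lborel (\<lambda>y. indicat_real ?B y *\<^sub>R (3 / \<epsilon> ^ 3 * kirchhoff_source z y - 3 / \<epsilon> ^ 3 * v (z, 0)))"
        using set_integral_diff(1)[OF i1 i2] by (simp add: set_integrable_def)
      show "integrable lborel (\<lambda>y. indicat_real ?B y *\<^sub>R (3 / \<epsilon> ^ 3 * (e / (4 * pi))))"
        using emeasure_bounded_finite[of ?B] by simp
      show "norm (indicat_real ?B y *\<^sub>R (3 / \<epsilon> ^ 3 * kirchhoff_source z y - 3 / \<epsilon> ^ 3 * v (z, 0)))
         \<le> indicat_real ?B y *\<^sub>R (3 / \<epsilon> ^ 3 * (e / (4 * pi)))" for y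
      proof (cases "y \<in> ?B")
        case True
        then have "\<bar>kirchhoff_source z y - v (z, 0)\<bar> \<le> e / (4 * pi)"
          using \<delta>(2)[of y] \<epsilon>(2) by (auto simp: dist_commute)
        then have "3 / \<epsilon> ^ 3 * \<bar>kirchhoff_source z y - v (z, 0)\<bar> \<le> 3 / \<epsilon> ^ 3 * (e / (4 * pi))"
          using \<epsilon>(1) by (intro mult_left_mono) auto
        moreover have "norm (3 / \<epsilon> ^ 3 * kirchhoff_source z y - 3 / \<epsilon> ^ 3 * v (z, 0))
            = 3 / \<epsilon> ^ 3 * \<bar>kirchhoff_source z y - v (z, 0)\<bar>"
          using \<epsilon>(1) by (simp add: right_diff_distrib[symmetric] abs_mult del: times_divide_eq_left)
        ultimately show ?thesis using True by simp
      qed simp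
    qed
    also have "\<dots> = e"
      using \<epsilon>(1) e by (simp add: set_lebesgue_integral_def vol)
    finally show ?thesis .
  qed
  then have "\<bar>kirchhoff_flux a z - 4 * pi * v (z, 0)\<bar> \<le> 0"
    by (rule field_le_epsilon[of _ 0, simplified])
  then show ?thesis by simp
qed

end

section \<open>Images of the evaluation point\<close>

text \<open>For even n the translation by 2na, for odd n the reflection in the point na: these maps
  form the group generated by the reflections in a and -a, indexed by the interval to which (-a, a)
  is moved.\<close>

definition image_coord :: "real \<Rightarrow> int \<Rightarrow> real \<Rightarrow> real" where
  "image_coord a n t = 2 * of_int n * a + (-1) powi n * t"

definition image_point :: "real \<Rightarrow> (3 \<Rightarrow> int) \<Rightarrow> real^3 \<Rightarrow> real^3" where
  "image_point a k x = (\<chi> j. image_coord a (k j) (x $ j))"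

definition index_triple :: "3 \<Rightarrow> int \<Rightarrow> int \<Rightarrow> int \<Rightarrow> 3 \<Rightarrow> int" where
  "index_triple i \<kappa> n m = (\<lambda>j. if j = i then \<kappa> else if j = i + 1 then n else m)"

definition image_indices :: "(3 \<Rightarrow> int) set" where
  "image_indices = {k. \<forall>j. k j \<in> {-2..2}}"

lemma index_triple_simps [simp]:
  "index_triple i \<kappa> n m i = \<kappa>" "index_triple i \<kappa> n m (i + 1) = n" "index_triple i \<kappa> n m (i + 2) = m"
  by (simp_all add: index_triple_def)

text \<open>The index of axis i runs innermost, so that the mirror pairs of a face normal to this
  axis can be collected for fixed tangential indices.\<close>

lemma sum_image_indices:
  "(\<Sum>k\<in>image_indices. F k) = (\<Sum>n\<in>{-2..2}. \<Sum>m\<in>{-2..2}. \<Sum>\<kappa>\<in>{-2..2}. F (index_triple i \<kappa> n m))"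
proof -
  have "(\<Sum>k\<in>image_indices. F k) =
      (\<Sum>(n, m, \<kappa>)\<in>{-2..2} \<times> {-2..2} \<times> {-2..2}. F (index_triple i \<kappa> n m))"
  proof (rule sum.reindex_bij_witness[where
        i = "\<lambda>(n, m, \<kappa>). index_triple i \<kappa> n m" and j = "\<lambda>k. (k (i + 1), k (i + 2), k i)"])
    have ext: "index_triple i (k i) (k (i + 1)) (k (i + 2)) = k" for k
      unfolding fun_eq_iff all_3_shift[of _ i] by simp
    show "(case (k (i + 1), k (i + 2), k i) of (n, m, \<kappa>) \<Rightarrow> index_triple i \<kappa> n m) = k" for k
      using ext by simp
    then show "(case (k (i + 1), k (i + 2), k i) of (n, m, \<kappa>) \<Rightarrow> F (index_triple i \<kappa> n m)) = F k" for k
      by simp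
  qed (auto simp: image_indices_def all_3_shift[of _ i])
  then show ?thesis by (simp add: sum.cartesian_product)
qed

lemma finite_image_indices: "finite image_indices"
proof -
  have "image_indices = (UNIV :: 3 set) \<rightarrow>\<^sub>E {-2..2}"
    by (auto simp: image_indices_def PiE_UNIV_domain)
  then show ?thesis by (metis finite_PiE finite_class.finite_UNIV finite_atLeastAtMost_int)
qed

lemma image_coord_simps:
  "image_coord a 0 t = t" "image_coord a 1 t = 2 * a - t" "image_coord a (-1) t = - 2 * a - t"
  "image_coord a 2 t = 4 * a + t" "image_coord a (-2) t = - 4 * a + t"
  by (simp_all add: image_coord_def power_int_def)

lemma abs_minus_one_powi [simp]: "\<bar>(-1::real) powi n\<bar> = 1"
  by (simp add: power_int_abs[symmetric])

text \<open>This places every image other than the evaluation point itself outside the closed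
  cube.\<close>

lemma abs_image_coord:
  assumes "n \<noteq> 0" "\<bar>t\<bar> < a"
  shows "\<bar>image_coord a n t\<bar> > a"
proof -
  have "2 * a \<le> \<bar>2 * real_of_int n * a\<bar>"
  proof -
    have "1 \<le> \<bar>real_of_int n\<bar>" using assms(1) by linarith
    moreover have "0 < a" using assms(2) by linarith
    ultimately have "1 * a \<le> \<bar>real_of_int n\<bar> * a" by (intro mult_right_mono) auto
    then show ?thesis using \<open>0 < a\<close> by (simp add: abs_mult)
  qed
  moreover have "\<bar>(-1) powi n * t\<bar> < a" using assms by (simp add: abs_mult)
  ultimately show ?thesis unfolding image_coord_def by linarith
qed

lemma norm_plane_point_diff_sqrt:
  "norm (plane_point i c u - z) = sqrt ((c - z $ i)\<^sup>2 + (fst u - z $ (i + 1))\<^sup>2 + (snd u - z $ (i + 2))\<^sup>2)"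
  by (simp add: norm_plane_point_diff[symmetric])

lemma norm_plane_point_ge: "\<bar>c - z $ i\<bar> \<le> norm (plane_point i c u - z)"
  using component_le_norm_cart[of "plane_point i c u - z" i] by simp

text \<open>Only the coordinates along the face are reflected. The reflections in the normal
  direction are absorbed by the choice between the planes at \<open>\<sigma> * a\<close> and
  \<open>- 3 * \<sigma> * a\<close>.\<close>

definition transverse_image :: "real \<Rightarrow> 3 \<Rightarrow> int \<Rightarrow> int \<Rightarrow> real^3 \<Rightarrow> real^3" where
  "transverse_image a i n m x =
     plane_point i (x $ i) (image_coord a n (x $ (i + 1)), image_coord a m (x $ (i + 2)))"

section \<open>Mirror pairs of images as seen from a face\<close>

context C2_wave
begin

definition face_flux :: "real \<Rightarrow> 3 \<Rightarrow> real \<Rightarrow> real^3 \<Rightarrow> real" where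
  "face_flux a i \<sigma> z = integral (square a)
     (\<lambda>u. kirchhoff z i (plane_point i (\<sigma> * a) u) / norm (plane_point i (\<sigma> * a) u - z) ^ 3)"

text \<open>The solution is read on the face, while distances and advanced times are measured from
  the parallel plane at c; in this way the data of one face can be placed on either plane. The
  factor c - z_i of the double layer kernel is kept outside.\<close>

definition double_layer :: "real \<Rightarrow> 3 \<Rightarrow> real \<Rightarrow> real \<Rightarrow> real^3 \<Rightarrow> real" where
  "double_layer a i \<sigma> c z = integral (square a) (\<lambda>u.
     (v (plane_point i (\<sigma> * a) u, norm (plane_point i c u - z)) - norm (plane_point i c u - z) *
      vt (plane_point i (\<sigma> * a) u, norm (plane_point i c u - z))) / norm (plane_point i c u - z) ^ 3)"

text \<open>Mirror images in the plane of a face see the points of the face at equal distances, so in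
  the difference of their fluxes the normal derivative of \<open>v\<close> cancels.\<close>

lemma face_flux_mirror:
  assumes "z $ i \<noteq> \<sigma> * a" "z' $ i = 2 * \<sigma> * a - z $ i"
    "z' $ (i + 1) = z $ (i + 1)" "z' $ (i + 2) = z $ (i + 2)"
  shows "face_flux a i \<sigma> z - face_flux a i \<sigma> z' = 2 * (\<sigma> * a - z $ i) * double_layer a i \<sigma> (\<sigma> * a) z"
proof -
  define y where "y = plane_point i (\<sigma> * a)"
  have nz: "norm (y u - w) \<noteq> 0" if "w $ i \<noteq> \<sigma> * a" for u w
    using that norm_plane_point_ge[of "\<sigma> * a" w i u] by (auto simp: y_def)
  have ne: "z' $ i \<noteq> \<sigma> * a" using assms by auto
  have int: "(\<lambda>u. kirchhoff w i (y u) / norm (y u - w) ^ 3) integrable_on square a" if "w $ i \<noteq> \<sigma> * a" for w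
    unfolding square_def using nz[OF that]
    by (intro integrable_continuous continuous_intros continuous_on_compose2[OF continuous_on_kirchhoff[of UNIV]])
      (auto simp: y_def intro!: continuous_intros)
  have eqn: "norm (y u - z') = norm (y u - z)" for u
  proof -
    have "\<sigma> * a - z' $ i = - (\<sigma> * a - z $ i)" using assms by simp
    then show ?thesis unfolding y_def norm_plane_point_diff_sqrt by (simp only: assms(3,4) power2_minus)
  qed
  have "face_flux a i \<sigma> z - face_flux a i \<sigma> z' =
    integral (square a) (\<lambda>u. kirchhoff z i (y u) / norm (y u - z) ^ 3 - kirchhoff z' i (y u) / norm (y u - z') ^ 3)"
    unfolding face_flux_def y_def[symmetric] by (rule integral_diff[symmetric]) (rule int assms ne)+
  also have "\<dots> = integral (square a) (\<lambda>u. 2 * (\<sigma> * a - z $ i) * ((v (y u, norm (y u - z)) -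
      norm (y u - z) * vt (y u, norm (y u - z))) / norm (y u - z) ^ 3))"
  proof (rule integral_cong)
    fix u
    have [simp]: "(y u - z) $ i = \<sigma> * a - z $ i" "(y u - z') $ i = - (\<sigma> * a - z $ i)"
      using assms by (simp_all add: y_def)
    have "kirchhoff z i (y u) - kirchhoff z' i (y u) = 2 * (\<sigma> * a - z $ i) * (v (y u, norm (y u - z)) -
      norm (y u - z) * vt (y u, norm (y u - z)))"
      unfolding kirchhoff_def light_cone_def eqn by (simp add: algebra_simps del: vector_minus_component)
    then show "kirchhoff z i (y u) / norm (y u - z) ^ 3 - kirchhoff z' i (y u) / norm (y u - z') ^ 3 =
      2 * (\<sigma> * a - z $ i) * ((v (y u, norm (y u - z)) - norm (y u - z) * vt (y u, norm (y u - z))) / norm (y u - z) ^ 3)"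
      unfolding eqn by (simp add: diff_divide_distrib[symmetric] del: vector_minus_component)
  qed
  finally show ?thesis
    unfolding double_layer_def y_def by (simp only: Henstock_Kurzweil_Integration.integral_mult_right)
qed

text \<open>The normal direction enters only through a squared difference. Hence an image seen from
  the face may be exchanged for a \<open>transverse_image\<close> seen from the other plane.\<close>

lemma double_layer_cong:
  assumes "(c - z $ i)\<^sup>2 = (c' - z' $ i)\<^sup>2" "z' $ (i + 1) = z $ (i + 1)" "z' $ (i + 2) = z $ (i + 2)"
  shows "double_layer a i \<sigma> c z = double_layer a i \<sigma> c' z'"
  unfolding double_layer_def norm_plane_point_diff_sqrt using assms by simp

lemma face_flux_far:
  assumes a: "a > 0" and \<sigma>: "\<sigma> \<in> {1, -1}" and far: "4 * a \<le> \<bar>\<sigma> * a - z $ i\<bar>"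
    and van: "\<And>y t. y \<in> closed_cube a \<Longrightarrow> 4 * a \<le> t \<Longrightarrow> v (y, t) = 0 \<and> vt (y, t) = 0 \<and> vx i (y, t) = 0"
  shows "face_flux a i \<sigma> z = 0"
proof -
  have "kirchhoff z i (plane_point i (\<sigma> * a) u) = 0" if "u \<in> square a" for u
  proof -
    have "plane_point i (\<sigma> * a) u \<in> closed_cube a"
      using that a \<sigma> by (auto simp: plane_point_in_closed_cube)
    moreover have "4 * a \<le> norm (plane_point i (\<sigma> * a) u - z)"
      using far norm_plane_point_ge order_trans by blast
    ultimately show ?thesis using van by (simp add: kirchhoff_def light_cone_def)
  qed
  then have "face_flux a i \<sigma> z = integral (square a) (\<lambda>u. 0)"
    unfolding face_flux_def by (intro integral_cong) simp
  then show ?thesis by simp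
qed

text \<open>For \<sigma> = 1 the indices 0, 1 and the indices 2, -1 form mirror pairs with respect
  to the face; their opposite parities supply the difference in \<open>face_flux_mirror\<close>.
  Index -2 is left over and is farther than 4a away. For \<sigma> = -1 all indices change
  sign.\<close>

lemma sum_face_flux_images:
  assumes a: "a > 0" and x: "x \<in> open_cube a" and \<sigma>: "\<sigma> \<in> {1, -1}"
    and van: "\<And>y t. y \<in> closed_cube a \<Longrightarrow> 4 * a \<le> t \<Longrightarrow> v (y, t) = 0 \<and> vt (y, t) = 0 \<and> vx i (y, t) = 0"
  shows "(\<Sum>\<kappa>\<in>{-2..2}. (-1) powi \<kappa> * face_flux a i \<sigma> (image_point a (index_triple i \<kappa> n m) x)) =
     2 * (\<Sum>c\<in>{\<sigma> * a, - 3 * \<sigma> * a}. (c - x $ i) * double_layer a i \<sigma> c (transverse_image a i n m x))"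
proof -
  define Z where "Z \<kappa> = image_point a (index_triple i \<kappa> n m) x" for \<kappa>
  have Z: "Z \<kappa> $ i = image_coord a \<kappa> (x $ i)" "Z \<kappa> $ (i + 1) = image_coord a n (x $ (i + 1))"
    "Z \<kappa> $ (i + 2) = image_coord a m (x $ (i + 2))" for \<kappa>
    by (simp_all add: Z_def image_point_def)
  note T = transverse_image_def
  have xi: "- a < x $ i" "x $ i < a" using x by (auto simp: open_cube_def)
  have s5: "{-2..2} = {-2, -1, 0, 1, 2::int}" by auto
  have pows: "(-1::real) powi (-2) = 1" "(-1::real) powi (-1) = -1" "(-1::real) powi 2 = 1"
    by (simp_all add: power_int_def)
  consider "\<sigma> = 1" | "\<sigma> = -1" using \<sigma> by auto
  then show ?thesis
  proof cases
    case 1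
    have "face_flux a i \<sigma> (Z (-2)) = 0"
      by (rule face_flux_far[OF a \<sigma> _ van]) (use 1 xi in \<open>auto simp: Z image_coord_simps\<close>)
    moreover have "face_flux a i \<sigma> (Z 0) - face_flux a i \<sigma> (Z 1) =
       2 * (\<sigma> * a - Z 0 $ i) * double_layer a i \<sigma> (\<sigma> * a) (Z 0)"
      by (rule face_flux_mirror) (use 1 xi in \<open>auto simp: Z image_coord_simps\<close>)
    moreover have "face_flux a i \<sigma> (Z 2) - face_flux a i \<sigma> (Z (-1)) =
       2 * (\<sigma> * a - Z 2 $ i) * double_layer a i \<sigma> (\<sigma> * a) (Z 2)"
      by (rule face_flux_mirror) (use 1 xi in \<open>auto simp: Z image_coord_simps\<close>)
    moreover have "double_layer a i \<sigma> (\<sigma> * a) (Z 0) = double_layer a i \<sigma> (\<sigma> * a) (transverse_image a i n m x)"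
      by (rule double_layer_cong) (auto simp: T Z image_coord_simps)
    \<comment> \<open>The image has height 4a + x_i, and a - (4a + x_i) = -3a - x_i. The equality
      holds with sign, so the factor in front is also the one of the plane at -3a.\<close>
    moreover have "double_layer a i \<sigma> (\<sigma> * a) (Z 2) = double_layer a i \<sigma> (- 3 * \<sigma> * a) (transverse_image a i n m x)"
      by (rule double_layer_cong) (use 1 in \<open>simp_all add: T Z image_coord_simps\<close>)
    ultimately show ?thesis
      unfolding Z_def[symmetric] s5 using 1 a
      by (simp add: pows Z image_coord_simps) (simp add: algebra_simps)
  next
    case 2
    have "face_flux a i \<sigma> (Z 2) = 0"
      by (rule face_flux_far[OF a \<sigma> _ van]) (use 2 xi in \<open>auto simp: Z image_coord_simps\<close>)
    moreover have "face_flux a i \<sigma> (Z 0) - face_flux a i \<sigma> (Z (-1)) =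
       2 * (\<sigma> * a - Z 0 $ i) * double_layer a i \<sigma> (\<sigma> * a) (Z 0)"
      by (rule face_flux_mirror) (use 2 xi in \<open>auto simp: Z image_coord_simps\<close>)
    moreover have "face_flux a i \<sigma> (Z (-2)) - face_flux a i \<sigma> (Z 1) =
       2 * (\<sigma> * a - Z (-2) $ i) * double_layer a i \<sigma> (\<sigma> * a) (Z (-2))"
      by (rule face_flux_mirror) (use 2 xi in \<open>auto simp: Z image_coord_simps\<close>)
    moreover have "double_layer a i \<sigma> (\<sigma> * a) (Z 0) = double_layer a i \<sigma> (\<sigma> * a) (transverse_image a i n m x)"
      by (rule double_layer_cong) (auto simp: T Z image_coord_simps)
    moreover have "double_layer a i \<sigma> (\<sigma> * a) (Z (-2)) = double_layer a i \<sigma> (- 3 * \<sigma> * a) (transverse_image a i n m x)"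
      by (rule double_layer_cong) (use 2 in \<open>simp_all add: T Z image_coord_simps\<close>)
    ultimately show ?thesis
      unfolding Z_def[symmetric] s5 using 2 a
      by (simp add: pows Z image_coord_simps) (simp add: algebra_simps)
  qed
qed

text \<open>In the alternating sum over all images only k = 0 contributes, with value 4 pi v (x, 0).
  The sign belonging to axis i is used up by the pairing, which brings a factor 2; the two
  tangential signs remain and become those of the replication.\<close>

lemma double_layer_representation:
  assumes a: "a > 0" and x: "x \<in> open_cube a"
    and van: "\<And>y t i. y \<in> closed_cube a \<Longrightarrow> 4 * a \<le> t \<Longrightarrow> v (y, t) = 0 \<and> vt (y, t) = 0 \<and> vx i (y, t) = 0"
  shows "2 * pi * v (x, 0) = (\<Sum>i\<in>UNIV. \<Sum>\<sigma>\<in>{1, -1}. \<sigma> * (\<Sum>c\<in>{\<sigma> * a, - 3 * \<sigma> * a}.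
    \<Sum>n\<in>{-2..2}. \<Sum>m\<in>{-2..2}. (-1) powi n * (-1) powi m *
      ((c - x $ i) * double_layer a i \<sigma> c (transverse_image a i n m x))))"
proof -
  define s :: "(3 \<Rightarrow> int) \<Rightarrow> real" where "s k = (\<Prod>j\<in>UNIV. (-1) powi k j)" for k
  have xj: "\<bar>x $ j\<bar> < a" for j using x by (auto simp: open_cube_def abs_less_iff minus_less_iff)
  have "(\<Sum>k\<in>image_indices. s k * kirchhoff_flux a (image_point a k x)) =
      (\<Sum>k\<in>image_indices. if k = (\<lambda>_. 0) then 4 * pi * v (x, 0) else 0)"
  proof (rule sum.cong[OF refl])
    fix k assume "k \<in> image_indices"
    show "s k * kirchhoff_flux a (image_point a k x) = (if k = (\<lambda>_. 0) then 4 * pi * v (x, 0) else 0)"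
    proof (cases "k = (\<lambda>_. 0)")
      case True
      then have "image_point a k x = x" by (simp add: image_point_def image_coord_simps vec_eq_iff)
      then show ?thesis using True kirchhoff_flux_inside[OF a x] by (simp add: s_def)
    next
      case False
      then obtain j where "k j \<noteq> 0" by auto
      then have "\<bar>image_point a k x $ j\<bar> > a" using abs_image_coord xj by (simp add: image_point_def)
      then have "image_point a k x \<notin> closed_cube a" unfolding mem_closed_cube by (metis abs_le_iff minus_le_iff not_less)
      then show ?thesis using False kirchhoff_flux_outside[OF a] by simp
    qed
  qed
  also have "\<dots> = 4 * pi * v (x, 0)"
    using finite_image_indices by (simp add: image_indices_def)
  finally have "4 * pi * v (x, 0) = (\<Sum>k\<in>image_indices. s k * kirchhoff_flux a (image_point a k x))" ..
  also have "\<dots> = (\<Sum>k\<in>image_indices. \<Sum>i\<in>UNIV. \<Sum>\<sigma>\<in>{1, -1}. \<sigma> * (s k * face_flux a i \<sigma> (image_point a k x)))"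
    unfolding kirchhoff_flux_def face_flux_def[symmetric] by (simp only: sum_distrib_left mult.left_commute)
  also have "\<dots> = (\<Sum>i\<in>UNIV. \<Sum>\<sigma>\<in>{1, -1}. \<Sum>k\<in>image_indices. \<sigma> * (s k * face_flux a i \<sigma> (image_point a k x)))"
    by (subst sum.swap, rule sum.cong[OF refl], rule sum.swap)
  also have "\<dots> = (\<Sum>i\<in>UNIV. \<Sum>\<sigma>\<in>{1, -1}. 2 * (\<sigma> * (\<Sum>c\<in>{\<sigma> * a, - 3 * \<sigma> * a}.
    \<Sum>n\<in>{-2..2}. \<Sum>m\<in>{-2..2}. (-1) powi n * (-1) powi m *
      ((c - x $ i) * double_layer a i \<sigma> c (transverse_image a i n m x)))))"
  proof (intro sum.cong refl)
    fix i :: 3 and \<sigma> :: real assume \<sigma>: "\<sigma> \<in> {1, -1}"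
    have "(\<Sum>k\<in>image_indices. s k * face_flux a i \<sigma> (image_point a k x)) =
       (\<Sum>n\<in>{-2..2}. \<Sum>m\<in>{-2..2}. (-1) powi n * (-1) powi m *
         (\<Sum>\<kappa>\<in>{-2..2}. (-1) powi \<kappa> * face_flux a i \<sigma> (image_point a (index_triple i \<kappa> n m) x)))"
      unfolding sum_image_indices[of _ i] sum_distrib_left s_def prod_3_shift[of _ i]
      by (simp add: mult_ac)
    also have "\<dots> = (\<Sum>n\<in>{-2..2}. \<Sum>m\<in>{-2..2}. \<Sum>c\<in>{\<sigma> * a, - 3 * \<sigma> * a}. 2 * ((-1) powi n * (-1) powi m *
         ((c - x $ i) * double_layer a i \<sigma> c (transverse_image a i n m x))))"
    proof (intro sum.cong refl)
      fix n m :: int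
      have "(\<Sum>\<kappa>\<in>{-2..2}. (-1) powi \<kappa> * face_flux a i \<sigma> (image_point a (index_triple i \<kappa> n m) x)) =
         2 * (\<Sum>c\<in>{\<sigma> * a, - 3 * \<sigma> * a}. (c - x $ i) * double_layer a i \<sigma> c (transverse_image a i n m x))"
        using sum_face_flux_images[OF a x \<sigma>] van by blast
      then show "(-1) powi n * (-1) powi m *
         (\<Sum>\<kappa>\<in>{-2..2}. (-1) powi \<kappa> * face_flux a i \<sigma> (image_point a (index_triple i \<kappa> n m) x)) =
         (\<Sum>c\<in>{\<sigma> * a, - 3 * \<sigma> * a}. 2 * ((-1) powi n * (-1) powi m *
         ((c - x $ i) * double_layer a i \<sigma> c (transverse_image a i n m x))))"
        by (simp only: sum_distrib_left mult_ac)
    qed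
    also have "\<dots> = (\<Sum>c\<in>{\<sigma> * a, - 3 * \<sigma> * a}. \<Sum>n\<in>{-2..2}. \<Sum>m\<in>{-2..2}. 2 * ((-1) powi n * (-1) powi m *
         ((c - x $ i) * double_layer a i \<sigma> c (transverse_image a i n m x))))"
      by (subst (2) sum.swap, rule sum.cong[OF refl], rule sum.swap)
    finally show "(\<Sum>k\<in>image_indices. \<sigma> * (s k * face_flux a i \<sigma> (image_point a k x))) =
      2 * (\<sigma> * (\<Sum>c\<in>{\<sigma> * a, - 3 * \<sigma> * a}. \<Sum>n\<in>{-2..2}. \<Sum>m\<in>{-2..2}. (-1) powi n * (-1) powi m *
      ((c - x $ i) * double_layer a i \<sigma> c (transverse_image a i n m x))))"
      by (simp only: sum_distrib_left[symmetric] mult.left_commute)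
  qed
  finally show ?thesis by (simp only: sum_distrib_left[symmetric])
qed

end

section \<open>Derivatives of the layer potentials\<close>

text \<open>A face normal to axis i contributes only to component i of the vector field, so the
  divergence needs its derivative in this direction only, and such a shift commutes with the
  tangential reflections.\<close>

lemma transverse_image_shift:
  "transverse_image a i n m (x + s *\<^sub>R axis i 1) = transverse_image a i n m x + s *\<^sub>R axis i 1"
  unfolding vec_eq_iff all_3_shift[of _ i]
  by (simp add: transverse_image_def) (simp add: axis_def)

context C2_wave
begin

definition single_layer :: "real \<Rightarrow> 3 \<Rightarrow> real \<Rightarrow> real \<Rightarrow> real^3 \<Rightarrow> real" where
  "single_layer a i \<sigma> c z = integral (square a) (\<lambda>u.
     vt (plane_point i (\<sigma> * a) u, norm (plane_point i c u - z)) / norm (plane_point i c u - z))"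

text \<open>The double layer with \<open>vt\<close> in place of \<open>v\<close>. It arises both
  from \<open>double_layer\<close> by differentiating in the time shift and from
  \<open>single_layer\<close> by differentiating in the normal direction, and so connects
  Kirchhoff's formula with the divergence.\<close>

definition double_layer_deriv :: "real \<Rightarrow> 3 \<Rightarrow> real \<Rightarrow> real \<Rightarrow> real^3 \<Rightarrow> real" where
  "double_layer_deriv a i \<sigma> c z = integral (square a) (\<lambda>u.
     (vt (plane_point i (\<sigma> * a) u, norm (plane_point i c u - z)) - norm (plane_point i c u - z) *
      vtt (plane_point i (\<sigma> * a) u, norm (plane_point i c u - z))) / norm (plane_point i c u - z) ^ 3)"

lemma time_derivative:
  "((\<lambda>s. v (y, s)) has_real_derivative vt (y, s)) (at s)"
  "((\<lambda>s. vt (y, s)) has_real_derivative vtt (y, s)) (at s)"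
proof -
  have "((\<lambda>s. (y, s)) has_derivative (\<lambda>d. (0, d))) (at s)"
    by (auto intro!: derivative_eq_intros)
  from has_derivative_compose[OF this v_der] has_derivative_compose[OF this vt_der]
  show "((\<lambda>s. v (y, s)) has_real_derivative vt (y, s)) (at s)"
    "((\<lambda>s. vt (y, s)) has_real_derivative vtt (y, s)) (at s)"
    by (simp_all add: has_field_derivative_def mult_commute_abs)
qed

text \<open>With r the distance, the derivative of r in z_i is -(c - z_i) / r, and that of vt / r in
  r is -(vt - r vtt) / r^2; their product is the integrand on the right.\<close>

lemma single_layer_has_derivative:
  assumes "z $ i \<noteq> c"
  shows "((\<lambda>s. single_layer a i \<sigma> c (z + s *\<^sub>R axis i 1)) has_real_derivative
     (c - z $ i) * double_layer_deriv a i \<sigma> c z) (at 0)"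
proof -
  define y where "y u = plane_point i (\<sigma> * a) u" for u
  \<comment> \<open>Moving z by s along the normal has the same effect on distances as moving the
    plane by -s.\<close>
  define R where "R s u = norm (plane_point i (c - s) u - z)" for s u
  define \<delta> where "\<delta> = \<bar>c - z $ i\<bar>"
  \<comment> \<open>For s in U the shifted plane does not reach z, so the distance stays
    nonzero.\<close>
  define U where "U = {- \<delta> <..< \<delta>}"
  have "\<delta> > 0" using assms by (simp add: \<delta>_def)
  then have U: "0 \<in> U" "open U" "convex U" by (auto simp: U_def)
  have R0: "R s u \<noteq> 0" if "s \<in> U" for s u
    using norm_plane_point_ge[of "c - s" z i u] that by (auto simp: R_def U_def \<delta>_def)
  have yc: "continuous_on S (\<lambda>p. y (snd p))" and Rc: "continuous_on S (\<lambda>p. R (fst p) (snd p))"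
    for S :: "(real \<times> real \<times> real) set"
    unfolding y_def R_def by (intro continuous_intros)+
  have yc': "continuous_on S y" and Rc': "continuous_on S (R s)" for S s
    unfolding y_def R_def by (intro continuous_intros)+
  note tc = continuous_on_compose2[OF vt_cont] continuous_on_compose2[OF vtt_cont]
  define D where "D s u = (c - s - z $ i) * ((vt (y u, R s u) - R s u * vtt (y u, R s u)) / R s u ^ 3)" for s u
  have dR: "((\<lambda>s. R s u) has_real_derivative - ((c - s - z $ i) / R s u)) (at s)" if "s \<in> U" for s u
  proof -
    have "((\<lambda>s. c - s) has_real_derivative - 1) (at s)" by (auto intro!: derivative_eq_intros)
    from DERIV_chain2[OF norm_along_plane_point[OF R0[OF that, unfolded R_def]] this]
    show ?thesis by (simp add: R_def)
  qed
  have der: "((\<lambda>s. integral (cbox (- a, - a) (a, a)) (\<lambda>u. vt (y u, R s u) / R s u)) has_real_derivative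
      integral (cbox (- a, - a) (a, a)) (D 0)) (at 0 within U)"
  proof (rule leibniz_rule_field_derivative)
    show "((\<lambda>s. vt (y u, R s u) / R s u) has_real_derivative D s u) (at s within U)" if "s \<in> U" for s u
    proof -
      have "((\<lambda>s. vt (y u, R s u) / R s u) has_real_derivative
          (vtt (y u, R s u) * - ((c - s - z $ i) / R s u) * R s u - vt (y u, R s u) * - ((c - s - z $ i) / R s u))
            / (R s u * R s u)) (at s)"
        by (intro DERIV_divide DERIV_chain2[OF time_derivative(2)] dR R0 that)
      also have "(vtt (y u, R s u) * - ((c - s - z $ i) / R s u) * R s u - vt (y u, R s u) * - ((c - s - z $ i) / R s u))
            / (R s u * R s u) = D s u"
        unfolding D_def using R0[OF that, of u]
        by (simp add: field_simps eval_nat_numeral)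
      finally show ?thesis by (rule has_field_derivative_at_within)
    qed
    show "(\<lambda>u. vt (y u, R s u) / R s u) integrable_on cbox (- a, - a) (a, a)" if "s \<in> U" for s
      using R0[OF that] by (intro integrable_continuous continuous_intros tc yc' Rc') auto
    show "continuous_on (U \<times> cbox (- a, - a) (a, a)) (\<lambda>(s, u). D s u)"
      unfolding D_def split_beta
      by (intro continuous_intros tc yc Rc) (use R0 in auto)
  qed (use U in auto)
  have n: "norm (plane_point i c u - (z + s *\<^sub>R axis i 1)) = R s u" for s u
  proof -
    have "plane_point i c u - (z + s *\<^sub>R axis i 1) = plane_point i (c - s) u - z"
      unfolding vec_eq_iff all_3_shift[of _ i] by (simp add: axis_def)
    then show ?thesis by (simp only: R_def)
  qed
  have D0: "integral (cbox (- a, - a) (a, a)) (D 0) = (c - z $ i) * double_layer_deriv a i \<sigma> c z"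
    unfolding D_def double_layer_deriv_def y_def R_def square_def
    by (simp only: Henstock_Kurzweil_Integration.integral_mult_right diff_zero)
  show ?thesis
    using der unfolding D0 at_within_open[OF U(1,2)]
    unfolding single_layer_def square_def n y_def .
qed

text \<open>The derivative at \<tau> = 0 is one-sided, since \<open>van\<close> passes to the
  shifted solution only for \<tau> \<ge> 0. Uniqueness of one-sided derivatives suffices to compare
  both sides.\<close>

lemma double_layer_deriv_representation:
  assumes a: "a > 0" and x: "x \<in> open_cube a"
    and van: "\<And>y t i. y \<in> closed_cube a \<Longrightarrow> 4 * a \<le> t \<Longrightarrow> v (y, t) = 0 \<and> vt (y, t) = 0 \<and> vx i (y, t) = 0"
  shows "2 * pi * vt (x, 0) = (\<Sum>i\<in>UNIV. \<Sum>\<sigma>\<in>{1, -1}. \<sigma> * (\<Sum>c\<in>{\<sigma> * a, - 3 * \<sigma> * a}.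
    \<Sum>n\<in>{-2..2}. \<Sum>m\<in>{-2..2}. (-1) powi n * (-1) powi m *
      ((c - x $ i) * double_layer_deriv a i \<sigma> c (transverse_image a i n m x))))"
proof -
  \<comment> \<open>The shift enters only the times at which \<open>v\<close> and \<open>vt\<close>
    are read; the distances in the kernel stay as they are.\<close>
  define L where "L i \<sigma> c z \<tau> = integral (cbox (- a, - a) (a, a)) (\<lambda>u.
     (v (plane_point i (\<sigma> * a) u, norm (plane_point i c u - z) + \<tau>) - norm (plane_point i c u - z) *
      vt (plane_point i (\<sigma> * a) u, norm (plane_point i c u - z) + \<tau>)) / norm (plane_point i c u - z) ^ 3)"
    for i \<sigma> c z \<tau>
  have dL: "((\<lambda>\<tau>. L i \<sigma> c z \<tau>) has_real_derivative double_layer_deriv a i \<sigma> c z) (at 0 within {0..})"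
    if "z $ i \<noteq> c" for i \<sigma> c z
  proof -
    define y where "y u = plane_point i (\<sigma> * a) u" for u
    define R where "R u = norm (plane_point i c u - z)" for u
    have R0: "R u \<noteq> 0" for u
      using norm_plane_point_ge[of c z i u] that by (auto simp: R_def)
    have yc: "continuous_on S (\<lambda>p. y (snd p))" and Rc: "continuous_on S (\<lambda>p. R (snd p))"
      for S :: "(real \<times> real \<times> real) set"
      unfolding y_def R_def by (intro continuous_intros)+
    have yc': "continuous_on S y" and Rc': "continuous_on S R" for S
      unfolding y_def R_def by (intro continuous_intros)+
    note tc = continuous_on_compose2[OF v_cont] continuous_on_compose2[OF vt_cont] continuous_on_compose2[OF vtt_cont]
    have "((\<lambda>\<tau>. integral (cbox (- a, - a) (a, a)) (\<lambda>u. (v (y u, R u + \<tau>) - R u * vt (y u, R u + \<tau>)) / R u ^ 3))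
      has_real_derivative integral (cbox (- a, - a) (a, a)) (\<lambda>u. (vt (y u, R u + 0) - R u * vtt (y u, R u + 0)) / R u ^ 3))
      (at 0 within {0..})"
    proof (rule leibniz_rule_field_derivative)
      fix \<tau> u
      have s: "((\<lambda>\<tau>. R u + \<tau>) has_real_derivative 1) (at \<tau>)"
        by (auto intro!: derivative_eq_intros)
      have "((\<lambda>\<tau>. (v (y u, R u + \<tau>) - R u * vt (y u, R u + \<tau>)) / R u ^ 3) has_real_derivative
          (vt (y u, R u + \<tau>) * 1 - R u * (vtt (y u, R u + \<tau>) * 1)) / R u ^ 3) (at \<tau>)"
        by (intro DERIV_cdivide DERIV_diff DERIV_cmult DERIV_chain2[OF time_derivative(1) s]
            DERIV_chain2[OF time_derivative(2) s])
      then show "((\<lambda>\<tau>. (v (y u, R u + \<tau>) - R u * vt (y u, R u + \<tau>)) / R u ^ 3) has_real_derivative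
          (vt (y u, R u + \<tau>) - R u * vtt (y u, R u + \<tau>)) / R u ^ 3) (at \<tau> within {0..})"
        by (simp add: has_field_derivative_at_within)
    next
      fix \<tau>
      show "(\<lambda>u. (v (y u, R u + \<tau>) - R u * vt (y u, R u + \<tau>)) / R u ^ 3) integrable_on cbox (- a, - a) (a, a)"
        using R0 by (intro integrable_continuous continuous_intros tc yc' Rc') auto
    next
      show "continuous_on ({0..} \<times> cbox (- a, - a) (a, a))
          (\<lambda>(\<tau>, u). (vt (y u, R u + \<tau>) - R u * vtt (y u, R u + \<tau>)) / R u ^ 3)"
        unfolding split_beta by (intro continuous_intros tc yc Rc) (use R0 in auto)
    qed auto
    then show ?thesis by (simp add: L_def double_layer_deriv_def y_def R_def square_def)
  qed
  have xi: "- a < x $ i" "x $ i < a" for i using x by (auto simp: open_cube_def)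
  have ne: "transverse_image a i n m x $ i \<noteq> c" if "\<sigma> \<in> {1, -1}" "c \<in> {\<sigma> * a, - 3 * \<sigma> * a}" for i n m \<sigma> c
    using that xi[of i] a by (auto simp: transverse_image_def)
  have rep: "2 * pi * v (x, \<tau>) = (\<Sum>i\<in>UNIV. \<Sum>\<sigma>\<in>{1, -1}. \<sigma> * (\<Sum>c\<in>{\<sigma> * a, - 3 * \<sigma> * a}.
    \<Sum>n\<in>{-2..2}. \<Sum>m\<in>{-2..2}. (-1) powi n * (-1) powi m *
      ((c - x $ i) * L i \<sigma> c (transverse_image a i n m x) \<tau>)))" if "\<tau> \<in> {0..}" for \<tau>
  proof -
    interpret shifted: C2_wave "\<lambda>q. v (fst q, snd q + \<tau>)" "\<lambda>q. vt (fst q, snd q + \<tau>)" "\<lambda>q. vtt (fst q, snd q + \<tau>)"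
     "\<lambda>i q. vx i (fst q, snd q + \<tau>)" "\<lambda>i q. vxt i (fst q, snd q + \<tau>)" "\<lambda>i j q. vxx i j (fst q, snd q + \<tau>)"
      by (rule time_shift)
    have "shifted.double_layer a i \<sigma> c z = L i \<sigma> c z \<tau>" for i \<sigma> c z
      by (simp add: shifted.double_layer_def L_def square_def)
    moreover have "v (fst (y, t), snd (y, t) + \<tau>) = 0 \<and> vt (fst (y, t), snd (y, t) + \<tau>) = 0 \<and>
      vx i (fst (y, t), snd (y, t) + \<tau>) = 0" if "y \<in> closed_cube a" "4 * a \<le> t" for y t i
      using van[OF that(1), of "t + \<tau>"] that \<open>\<tau> \<in> {0..}\<close> by auto
    ultimately show ?thesis
      using shifted.double_layer_representation[OF a x] by simp
  qed
  have "((\<lambda>\<tau>. \<Sum>i\<in>UNIV. \<Sum>\<sigma>\<in>{1, -1}. \<sigma> * (\<Sum>c\<in>{\<sigma> * a, - 3 * \<sigma> * a}.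
    \<Sum>n\<in>{-2..2}. \<Sum>m\<in>{-2..2}. (-1) powi n * (-1) powi m *
      ((c - x $ i) * L i \<sigma> c (transverse_image a i n m x) \<tau>))) has_real_derivative
    (\<Sum>i\<in>UNIV. \<Sum>\<sigma>\<in>{1, -1}. \<sigma> * (\<Sum>c\<in>{\<sigma> * a, - 3 * \<sigma> * a}.
    \<Sum>n\<in>{-2..2}. \<Sum>m\<in>{-2..2}. (-1) powi n * (-1) powi m *
      ((c - x $ i) * double_layer_deriv a i \<sigma> c (transverse_image a i n m x))))) (at 0 within {0..})"
    by (intro DERIV_sum DERIV_cmult dL ne)
  moreover have "((\<lambda>\<tau>. 2 * pi * v (x, \<tau>)) has_real_derivative 2 * pi * vt (x, 0)) (at 0 within {0..})"
    by (rule DERIV_cmult, rule has_field_derivative_at_within, rule time_derivative)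
  then have "((\<lambda>\<tau>. \<Sum>i\<in>UNIV. \<Sum>\<sigma>\<in>{1, -1}. \<sigma> * (\<Sum>c\<in>{\<sigma> * a, - 3 * \<sigma> * a}.
    \<Sum>n\<in>{-2..2}. \<Sum>m\<in>{-2..2}. (-1) powi n * (-1) powi m *
      ((c - x $ i) * L i \<sigma> c (transverse_image a i n m x) \<tau>))) has_real_derivative 2 * pi * vt (x, 0)) (at 0 within {0..})"
    by (rule has_field_derivative_transform_within[where d = 1]) (use rep in auto)
  moreover have "at (0::real) within {0..} \<noteq> bot"
    by (simp add: at_within_Ici_at_right)
  ultimately show ?thesis by (intro has_field_derivative_unique)
qed

end

section \<open>The replicated data\<close>

definition replication_cell :: "real \<Rightarrow> int \<Rightarrow> int \<Rightarrow> (real \<times> real) set" where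
  "replication_cell a n m = {\<xi>. \<bar>fst \<xi> - 2 * of_int n * a\<bar> < a \<and> \<bar>snd \<xi> - 2 * of_int m * a\<bar> < a}"

text \<open>The index of the inverse of \<open>image_coord a n\<close>: the translation for even n
  is undone by index -n, while the reflections for odd n are involutions.\<close>

definition flip_index :: "int \<Rightarrow> int" where
  "flip_index n = (if even n then - n else n)"

lemma flip_flip_index [simp]: "flip_index (flip_index n) = n"
  by (simp add: flip_index_def)

lemma powi_flip_index [simp]: "(-1::real) powi flip_index n = (-1) powi n"
  by (simp add: flip_index_def power_int_minus_one_minus)

text \<open>The right-hand side is the argument that \<open>replicate2D\<close> passes to h.
  Replication thus maps a point back to the central square by the inverse image map.\<close>

lemma image_coord_flip_index: "image_coord a (flip_index n) t = (-1) powi n * (t - 2 * of_int n * a)"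
  by (simp add: image_coord_def) (auto simp: flip_index_def algebra_simps)

lemma minus_one_powi_mult_self [simp]: "(-1::real) powi n * ((-1) powi n * t) = t"
  by (cases "even n") auto

lemma image_coord_inverse: "image_coord a (flip_index n) (image_coord a n t) = t"
  unfolding image_coord_flip_index by (simp add: image_coord_def)

lemma abs_image_coord_flip: "\<bar>image_coord a (flip_index n) t\<bar> = \<bar>t - 2 * of_int n * a\<bar>"
  unfolding image_coord_flip_index by (simp add: abs_mult)

text \<open>The open cells are disjoint, so at most one term is nonzero, and at points in no cell
  both sides vanish. A point with coordinates below 5a in absolute value can lie only in cells with
  indices from -2 to 2.\<close>

lemma replicate2D_eq_sum:
  assumes a: "a > 0" and \<xi>: "\<bar>fst \<xi>\<bar> < 5 * a" "\<bar>snd \<xi>\<bar> < 5 * a"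
  shows "replicate2D a h \<xi> = (\<Sum>n\<in>{-2..2}. \<Sum>m\<in>{-2..2}. (-1) powi n * (-1) powi m *
     (indicator (replication_cell a n m) \<xi> * h (image_coord a (flip_index n) (fst \<xi>), image_coord a (flip_index m) (snd \<xi>))))"
    (is "_ = (\<Sum>n\<in>_. \<Sum>m\<in>_. ?t n m)")
proof (cases "\<exists>n m. \<xi> \<in> replication_cell a n m")
  case True
  then obtain N M where NM: "\<xi> \<in> replication_cell a N M" by blast
  have eq: "n = N \<and> m = M" if "\<xi> \<in> replication_cell a n m" for n m
    using that NM round_cell unfolding replication_cell_def mem_Collect_eq by metis
  have range: "K \<in> {-2..2}" if "\<bar>t - 2 * of_int K * a\<bar> < a" "\<bar>t\<bar> < 5 * a" for K and t :: real
  proof -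
    have "\<bar>2 * of_int K * a\<bar> < 6 * a" using that by linarith
    then have "\<bar>of_int K\<bar> * a < 3 * a" using a by (simp add: abs_mult)
    then have "\<bar>real_of_int K\<bar> < 3" using a by simp
    then show ?thesis by auto
  qed
  have NM2: "N \<in> {-2..2}" "M \<in> {-2..2}"
    using NM \<xi> range unfolding replication_cell_def by auto
  have "(\<Sum>n\<in>{-2..2}. \<Sum>m\<in>{-2..2}. ?t n m) =
      (\<Sum>n\<in>{-2..2}. \<Sum>m\<in>{-2..2}. if m = M then (if n = N then ?t N M else 0) else 0)"
  proof (intro sum.cong refl)
    fix n m
    show "?t n m = (if m = M then (if n = N then ?t N M else 0) else 0)"
    proof (cases "\<xi> \<in> replication_cell a n m")
      case True
      then show ?thesis using eq[OF True] by simp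
    next
      case False
      then show ?thesis using NM by (cases "n = N"; cases "m = M") auto
    qed
  qed
  also have "\<dots> = ?t N M" using NM2 by simp
  also have "\<dots> = replicate2D a h \<xi>"
    using NM replicate2D_cell[of "fst \<xi>" N a "snd \<xi>" M h]
    by (simp add: replication_cell_def image_coord_flip_index power_int_add mult.commute)
  finally show ?thesis ..
next
  case False
  then have "replicate2D a h \<xi> = 0"
    using replicate2D_boundary[of "fst \<xi>" a "snd \<xi>" h] by (simp add: replication_cell_def)
  with False show ?thesis by simp
qed

lemma lborel_image_coord:
  "distr lborel borel (\<lambda>u. (image_coord a n (fst u), image_coord a m (snd u))) = lborel"
proof -
  define c :: "real \<times> real \<Rightarrow> real" where "c j = (if j = (1, 0) then (-1) powi n else (-1) powi m)" for j
  have c: "\<bar>c j\<bar> = 1" for j by (simp add: c_def)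
  then have c0: "c j \<noteq> 0" for j by (metis abs_zero zero_neq_one)
  have B: "(Basis :: (real \<times> real) set) = {(1, 0), (0, 1)}" by (auto simp: Basis_prod_def)
  have T: "(2 * of_int n * a, 2 * of_int m * a) + (\<Sum>j\<in>Basis. (c j * (u \<bullet> j)) *\<^sub>R j) =
      (image_coord a n (fst u), image_coord a m (snd u))" for u
    unfolding B by (cases u) (simp add: c_def image_coord_def)
  show ?thesis
    using lborel_affine_euclidean[of c "(2 * of_int n * a, 2 * of_int m * a)", OF c0]
    unfolding T by (simp add: c density_1)
qed

text \<open>Each \<open>image_coord\<close> is an isometry of the line and can be undone in both
  points at once: the point of integration returns to the square, and x moves to one of its
  images.\<close>

lemma norm_image_coord:
  "norm (plane_point i c (image_coord a n (fst u), image_coord a m (snd u)) - x) =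
   norm (plane_point i c u - transverse_image a i (flip_index n) (flip_index m) x)"
proof -
  have "(image_coord a n s - t)\<^sup>2 = (s - image_coord a (flip_index n) t)\<^sup>2" for n s t
  proof -
    have "image_coord a n s - t = (-1) powi n * (s - image_coord a (flip_index n) t)"
      unfolding image_coord_flip_index by (simp add: image_coord_def right_diff_distrib)
    then show ?thesis by (simp add: power_mult_distrib power2_eq_square[of "_ powi _"])
  qed
  then show ?thesis
    unfolding norm_plane_point_diff_sqrt by (simp add: transverse_image_def)
qed

lemma plane_point_plane_coords: "y \<in> coord_plane i c \<Longrightarrow> plane_point i c (plane_coords i y) = y"
  unfolding vec_eq_iff all_3_shift[of _ i] by (simp add: coord_plane_def plane_coords_def)

lemma plane_coords_plane_point [simp]: "plane_coords i (plane_point i c z) = z"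
  by (simp add: plane_coords_def)

lemma plane_point_in_frontier:
  assumes "\<sigma> \<in> {1, -1}" "\<bar>fst z\<bar> < a" "\<bar>snd z\<bar> < a"
  shows "plane_point i (\<sigma> * a) z \<in> frontier (open_cube a)"
proof -
  have eq: "open_cube a = box (\<chi> i. - a) (\<chi> i. a)"
    by (auto simp: open_cube_def mem_box_cart)
  have "a > 0" using assms by auto
  then have "(0 :: real^3) \<in> open_cube a" by (simp add: open_cube_def)
  then have "closure (open_cube a) = closed_cube a"
    unfolding eq closed_cube_def by (intro closure_box) auto
  moreover have "interior (open_cube a) = open_cube a"
    unfolding eq by (rule interior_open, rule open_box)
  moreover have "plane_point i (\<sigma> * a) z \<in> closed_cube a"
    using assms \<open>a > 0\<close> by (auto simp: plane_point_in_closed_cube mem_square)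
  moreover have "plane_point i (\<sigma> * a) z \<notin> open_cube a"
    using assms by (auto simp: open_cube_def all_3_shift[of _ i])
  ultimately show ?thesis by (simp add: frontier_def)
qed

text \<open>At distances of at least T the data vanish by \<open>van\<close>, so the integral over
  the ball equals one over five by five whole cells. Each cell is carried back to the square by an
  isometry, at the price of replacing x by a transverse image.\<close>

lemma plane_integral_eq:
  fixes q :: "(real^3) \<times> real \<Rightarrow> real"
  assumes a: "a > 0" and T: "T \<le> 4 * a" and x: "x \<in> open_cube a" and \<sigma>: "\<sigma> \<in> {1, -1}" and c: "c \<noteq> x $ i"
    and q: "continuous_on UNIV q"
    and P: "\<And>y t. y \<in> frontier (open_cube a) \<Longrightarrow> 0 \<le> t \<Longrightarrow> P y t = q (y, t)"
    and van: "\<And>y t. y \<in> closed_cube a \<Longrightarrow> T \<le> t \<Longrightarrow> q (y, t) = 0"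
  shows "(LINT y:coord_plane i c \<inter> ball x T|plane_area i c.
       (replicated_data a P i \<sigma> y (dist y x) / dist y x) *\<^sub>R N) =
    (\<Sum>n\<in>{-2..2}. \<Sum>m\<in>{-2..2}. (-1) powi n * (-1) powi m *
       integral (square a) (\<lambda>u. q (plane_point i (\<sigma> * a) u, norm (plane_point i c u - transverse_image a i n m x))
         / norm (plane_point i c u - transverse_image a i n m x))) *\<^sub>R (N :: real^3)"
proof -
  define r where "r \<xi> = norm (plane_point i c \<xi> - x)" for \<xi>
  define A where "A n m \<xi> = (image_coord a n (fst \<xi>), image_coord a m (snd \<xi>))" for n m \<xi>
  define H where "H n m \<xi> = indicator (replication_cell a n m) \<xi> *
    (q (plane_point i (\<sigma> * a) (A (flip_index n) (flip_index m) \<xi>), r \<xi>) / r \<xi>)" for n m \<xi>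
  define W where "W \<xi> = (\<Sum>n\<in>{-2..2}. \<Sum>m\<in>{-2..2}. (-1) powi n * (-1) powi m * H n m \<xi>)" for \<xi>
  have r0: "r \<xi> \<noteq> 0" for \<xi>
    using norm_plane_point_ge[of c x i \<xi>] c by (auto simp: r_def)
  have rc: "continuous_on S r" for S unfolding r_def by (intro continuous_intros)
  have Ac: "continuous_on S (A n m)" for S n m
    unfolding A_def image_coord_def by (intro continuous_intros)
  have cell: "replication_cell a n m = box (2 * of_int n * a - a, 2 * of_int m * a - a) (2 * of_int n * a + a, 2 * of_int m * a + a)" for n m
    by (auto simp: replication_cell_def mem_box Basis_prod_def inner_Pair)
  have Hi: "integrable lborel (H n m)" for n m
  proof -
    have "continuous_on (cbox l u) (\<lambda>\<xi>. q (plane_point i (\<sigma> * a) (A (flip_index n) (flip_index m) \<xi>), r \<xi>) / r \<xi>)" for l u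
      using r0 by (intro continuous_intros continuous_on_compose2[OF q] rc Ac) auto
    then have "set_integrable lborel (box l u)
        (\<lambda>\<xi>. q (plane_point i (\<sigma> * a) (A (flip_index n) (flip_index m) \<xi>), r \<xi>) / r \<xi>)" for l u
      by (rule set_integrable_subset[OF set_integrable_continuous[OF compact_cbox[of l u]]]) (auto simp: box_subset_cbox)
    then have "set_integrable lborel (replication_cell a n m)
        (\<lambda>\<xi>. q (plane_point i (\<sigma> * a) (A (flip_index n) (flip_index m) \<xi>), r \<xi>) / r \<xi>)"
      unfolding cell .
    then show ?thesis by (simp add: set_integrable_def H_def[abs_def])
  qed
  have Wi: "integrable lborel W"
    unfolding W_def by (intro Bochner_Integration.integrable_sum integrable_mult_right Hi)
  have in_cell: "A (flip_index n) (flip_index m) \<xi> \<in> square a" "plane_point i (\<sigma> * a) (A (flip_index n) (flip_index m) \<xi>) \<in> frontier (open_cube a)"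
    if "\<xi> \<in> replication_cell a n m" for n m \<xi>
  proof -
    have *: "\<bar>fst (A (flip_index n) (flip_index m) \<xi>)\<bar> < a" "\<bar>snd (A (flip_index n) (flip_index m) \<xi>)\<bar> < a"
      using that by (simp_all add: A_def abs_image_coord_flip replication_cell_def)
    then show "A (flip_index n) (flip_index m) \<xi> \<in> square a" by (auto simp: mem_square)
    show "plane_point i (\<sigma> * a) (A (flip_index n) (flip_index m) \<xi>) \<in> frontier (open_cube a)"
      using plane_point_in_frontier[OF \<sigma> *] .
  qed
  have W: "indicator (coord_plane i c \<inter> ball x T) y * (replicated_data a P i \<sigma> y (dist y x) / dist y x)
      = indicator (coord_plane i c) y * W (plane_coords i y)" for y
  proof (cases "y \<in> coord_plane i c")
    case True
    define \<xi> where "\<xi> = plane_coords i y"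
    have y: "y = plane_point i c \<xi>" using plane_point_plane_coords[OF True] by (simp add: \<xi>_def)
    have d: "dist y x = r \<xi>" by (simp add: r_def y dist_norm)
    show ?thesis
    proof (cases "dist y x < T")
      case less: True
      have "\<bar>y $ j - x $ j\<bar> < 4 * a" for j
        using component_le_norm_cart[of "y - x" j] less T by (simp add: dist_norm)
      moreover have "\<bar>x $ j\<bar> < a" for j using x by (auto simp: open_cube_def abs_less_iff minus_less_iff)
      \<comment> \<open>The radius, at most 4a, and the bound a on the coordinates of x add up to
        the range covered by five cells.\<close>
      ultimately have "\<bar>y $ j\<bar> < 5 * a" for j
        using abs_triangle_ineq[of "y $ j - x $ j" "x $ j"] by (smt (verit, best) diff_add_cancel)
      then have "\<bar>fst \<xi>\<bar> < 5 * a" "\<bar>snd \<xi>\<bar> < 5 * a" by (simp_all add: \<xi>_def plane_coords_def)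
      then have "replicated_data a P i \<sigma> y (dist y x) = (\<Sum>n\<in>{-2..2}. \<Sum>m\<in>{-2..2}. (-1) powi n * (-1) powi m *
       (indicator (replication_cell a n m) \<xi> * P (plane_point i (\<sigma> * a) (A (flip_index n) (flip_index m) \<xi>)) (dist y x)))"
        unfolding replicated_data_def \<xi>_def[symmetric] A_def by (rule replicate2D_eq_sum[OF a])
      \<comment> \<open>P is known on the boundary of the cube only; the indicator selects the
        points that the inverse image map sends into a face.\<close>
      also have "\<dots> = (\<Sum>n\<in>{-2..2}. \<Sum>m\<in>{-2..2}. (-1) powi n * (-1) powi m *
       (indicator (replication_cell a n m) \<xi> * q (plane_point i (\<sigma> * a) (A (flip_index n) (flip_index m) \<xi>), dist y x)))"
        using in_cell(2) P by (intro sum.cong refl) (auto simp: indicator_def)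
      finally have "replicated_data a P i \<sigma> y (dist y x) / dist y x = W \<xi>"
        by (simp add: W_def H_def d sum_divide_distrib)
      then show ?thesis using less by (simp add: \<xi>_def indicator_def dist_commute)
    next
      case False
      then have "H n m \<xi> = 0" for n m
        using van in_cell(1)[of \<xi> n m] a \<sigma> d
        by (cases "\<xi> \<in> replication_cell a n m") (auto simp: H_def plane_point_in_closed_cube)
      then have "W \<xi> = 0" by (simp add: W_def)
      then show ?thesis using False by (simp add: \<xi>_def indicator_def dist_commute)
    qed
  qed simp
  have ppm: "plane_point i c \<in> measurable borel borel"
    by (intro borel_measurable_continuous_onI continuous_intros)
  have Wm: "(\<lambda>y. indicator (coord_plane i c) y * W (plane_coords i y)) \<in> borel_measurable borel"
  proof (intro borel_measurable_times borel_measurable_indicator)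
    have "closed (coord_plane i c)"
      unfolding coord_plane_def by (intro closed_Collect_eq continuous_intros)
    then show "coord_plane i c \<in> sets borel" by (rule borel_closed)
    have "plane_coords i \<in> measurable borel borel"
      unfolding plane_coords_def[abs_def] by (intro borel_measurable_continuous_onI continuous_intros)
    moreover have "W \<in> borel_measurable borel" using Wi by auto
    ultimately show "(\<lambda>y. W (plane_coords i y)) \<in> borel_measurable borel" by (rule measurable_compose)
  qed
  have ind: "indicator (coord_plane i c) (plane_point i c \<xi>) = (1::real)" for \<xi>
    by (simp add: coord_plane_def)
  have int: "integrable (plane_area i c) (\<lambda>y. indicator (coord_plane i c) y * W (plane_coords i y))"
    unfolding plane_area_def using Wi Wm ppm by (subst integrable_distr_eq) (simp_all add: ind)
  have "(LINT y:coord_plane i c \<inter> ball x T|plane_area i c. (replicated_data a P i \<sigma> y (dist y x) / dist y x) *\<^sub>R N)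
      = (\<integral>y. (indicator (coord_plane i c) y * W (plane_coords i y)) *\<^sub>R N \<partial>plane_area i c)"
    unfolding set_lebesgue_integral_def W[symmetric] by simp
  also have "\<dots> = (\<integral>y. indicator (coord_plane i c) y * W (plane_coords i y) \<partial>plane_area i c) *\<^sub>R N"
    using int by (intro integral_scaleR_left)
  also have "(\<integral>y. indicator (coord_plane i c) y * W (plane_coords i y) \<partial>plane_area i c) = integral\<^sup>L lborel W"
    unfolding plane_area_def using Wm ppm by (subst integral_distr) (simp_all add: ind)
  also have "\<dots> = (\<Sum>n\<in>{-2..2}. \<Sum>m\<in>{-2..2}. (-1) powi n * (-1) powi m * integral\<^sup>L lborel (H n m))"
    unfolding W_def using Hi
    by (simp add: Bochner_Integration.integral_sum)
  also have "\<dots> = (\<Sum>n\<in>{-2..2}. \<Sum>m\<in>{-2..2}. (-1) powi flip_index n * (-1) powi flip_index m *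
       integral (square a) (\<lambda>u. q (plane_point i (\<sigma> * a) u, norm (plane_point i c u - transverse_image a i (flip_index n) (flip_index m) x))
         / norm (plane_point i c u - transverse_image a i (flip_index n) (flip_index m) x)))"
  proof (intro sum.cong refl)
    fix n m :: int
    define z where "z = transverse_image a i (flip_index n) (flip_index m) x"
    have z0: "norm (plane_point i c u - z) \<noteq> 0" for u
      using norm_plane_point_ge[of c z i u] c by (auto simp: z_def transverse_image_def)
    have Am: "A n m \<in> measurable borel borel" by (intro borel_measurable_continuous_onI Ac)
    have AA: "A (flip_index n) (flip_index m) (A n m u) = u" for u by (simp add: A_def image_coord_inverse)
    have Acell: "A n m u \<in> replication_cell a n m \<longleftrightarrow> u \<in> box (- a, - a) (a, a)" for u
    proof -
      have "A n m u \<in> replication_cell a n m \<longleftrightarrow> \<bar>fst u\<bar> < a \<and> \<bar>snd u\<bar> < a"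
        by (simp add: A_def replication_cell_def image_coord_def abs_mult)
      then show ?thesis by (cases u) (auto simp: mem_box Basis_prod_def inner_Pair abs_less_iff)
    qed
    have "integral\<^sup>L lborel (H n m) = integral\<^sup>L lborel (\<lambda>u. H n m (A n m u))"
      by (subst lborel_image_coord[of a n m, symmetric], subst integral_distr)
        (use Hi Am in \<open>auto simp: A_def[abs_def]\<close>)
    also have "\<dots> = (LINT u:box (- a, - a) (a, a)|lborel. q (plane_point i (\<sigma> * a) u, norm (plane_point i c u - z))
         / norm (plane_point i c u - z))"
      unfolding set_lebesgue_integral_def
    proof (rule Bochner_Integration.integral_cong[OF refl])
      fix u
      have "r (A n m u) = norm (plane_point i c u - z)"
        unfolding r_def A_def z_def by (rule norm_image_coord)
      then show "H n m (A n m u) = indicator (box (- a, - a) (a, a)) u *\<^sub>R (q (plane_point i (\<sigma> * a) u, norm (plane_point i c u - z))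
         / norm (plane_point i c u - z))"
        by (simp add: H_def AA Acell indicator_def)
    qed
    also have "\<dots> = integral (box (- a, - a) (a, a)) (\<lambda>u. q (plane_point i (\<sigma> * a) u, norm (plane_point i c u - z))
         / norm (plane_point i c u - z))"
    proof (rule set_borel_integral_eq_integral(2), rule set_integrable_subset[OF set_integrable_continuous[of "cbox (- a, - a) (a, a)"]])
      show "continuous_on (cbox (- a, - a) (a, a)) (\<lambda>u. q (plane_point i (\<sigma> * a) u, norm (plane_point i c u - z))
         / norm (plane_point i c u - z))"
        using z0 by (intro continuous_intros continuous_on_compose2[OF q]) auto
    qed (auto simp: box_subset_cbox)
    also have "\<dots> = integral (square a) (\<lambda>u. q (plane_point i (\<sigma> * a) u, norm (plane_point i c u - z))
         / norm (plane_point i c u - z))"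
      unfolding square_def by (rule integral_open_interval)
    finally show "(-1) powi n * (-1) powi m * integral\<^sup>L lborel (H n m) =
       (-1) powi flip_index n * (-1) powi flip_index m *
       integral (square a) (\<lambda>u. q (plane_point i (\<sigma> * a) u, norm (plane_point i c u - transverse_image a i (flip_index n) (flip_index m) x))
         / norm (plane_point i c u - transverse_image a i (flip_index n) (flip_index m) x))"
      by (simp add: z_def)
  qed
  also have "\<dots> = (\<Sum>n\<in>{-2..2}. \<Sum>m\<in>{-2..2}. (-1) powi n * (-1) powi m *
       integral (square a) (\<lambda>u. q (plane_point i (\<sigma> * a) u, norm (plane_point i c u - transverse_image a i n m x))
         / norm (plane_point i c u - transverse_image a i n m x)))"
  proof -
    \<comment> \<open>The change of variables produced the indices of the inverse maps.
      \<open>flip_index\<close> permutes -2 to 2 and preserves parity, so the original indexing can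
      be restored.\<close>
    have re: "(\<Sum>n\<in>{-2..2}. F (flip_index n)) = (\<Sum>n\<in>{-2..2}. F n)" for F :: "int \<Rightarrow> real"
      by (rule sum.reindex_bij_witness[where i = flip_index and j = flip_index])
        (auto simp: flip_index_def)
    show ?thesis by (subst re, rule sum.cong[OF refl], rule re)
  qed
  finally show ?thesis .
qed

section \<open>The reconstruction formula\<close>

lemma transverse_image_nth: "transverse_image a i n m x $ i = x $ i"
  by (simp add: transverse_image_def)

text \<open>Since x is interior, every coordinate difference is strictly below 2a. Strictness is
  what makes the data vanish already at time T itself.\<close>

lemma norm_diff_less_cube_diameter:
  assumes "a > 0" "y \<in> closed_cube a" "x \<in> open_cube a"
  shows "norm (x - y) < 2 * sqrt 3 * a"
proof -
  have "((x - y) $ j)\<^sup>2 < (2 * a)\<^sup>2" for j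
  proof -
    have "- a \<le> y $ j" "y $ j \<le> a" "- a < x $ j" "x $ j < a"
      using assms by (auto simp: mem_closed_cube open_cube_def)
    then have "\<bar>(x - y) $ j\<bar> < 2 * a" by auto
    then show ?thesis by (metis abs_ge_zero power2_abs power2_less_imp_less power_strict_mono pos2)
  qed
  then have "(\<Sum>j\<in>UNIV. ((x - y) $ j)\<^sup>2) < (\<Sum>j\<in>(UNIV :: 3 set). (2 * a)\<^sup>2)"
    by (intro sum_strict_mono) auto
  then have "(norm (x - y))\<^sup>2 < (2 * sqrt 3 * a)\<^sup>2"
    unfolding sum_squares_norm by (simp add: power_mult_distrib)
  then show ?thesis
    by (rule power2_less_imp_less) (use assms(1) in simp)
qed

text \<open>Huygens' principle: from time T on, the sphere of radius t around y no longer meets the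
  open cube. With the weight arbitrary, this covers the solution and its first derivatives
  alike.\<close>

lemma sphere_avg_eq_0:
  assumes a: "a > 0" and \<phi>: "\<And>z. z \<notin> open_cube a \<Longrightarrow> \<phi> z = 0"
    and y: "y \<in> closed_cube a" and t: "2 * sqrt 3 * a \<le> t"
  shows "sphere_avg k \<phi> (y, t) = 0"
proof -
  have "\<phi> (y + t *\<^sub>R sphere_point z) = 0" for z
  proof (rule \<phi>)
    have "0 \<le> t" using a t by (smt (verit) mult_nonneg_nonneg real_sqrt_ge_zero)
    then have "norm (y + t *\<^sub>R sphere_point z - y) = t" by (simp add: norm_sphere_point)
    then show "y + t *\<^sub>R sphere_point z \<notin> open_cube a"
      using norm_diff_less_cube_diameter[OF a y] t by force
  qed
  then show ?thesis by (simp add: sphere_avg_def)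
qed

theorem theorem1:
  fixes a T :: real
    and f :: "real^3 \<Rightarrow> real"
    and p P :: "real^3 \<Rightarrow> real \<Rightarrow> real"
    and x :: "real^3"
  assumes "a > 0"
    and "T = diameter (open_cube a)"
    and "C2_compact_support (open_cube a) f"
    and "\<And>y t. t \<ge> 0 \<Longrightarrow> p y t = wave_solution f y t"
    and "\<And>y t. y \<in> frontier (open_cube a) \<Longrightarrow> t \<ge> 0 \<Longrightarrow> P y t = p y t"
    and "x \<in> open_cube a"
  shows "\<exists>d. has_divergence (\<lambda>x. \<Sum>i\<in>UNIV. \<Sum>\<sigma>\<in>{1, -1}. face_integral a P T i \<sigma> x) d x \<and>
             f x = 1 / (2 * pi) * d"
proof -
  note a = assms(1) and x = assms(6)
  have T: "T = 2 * sqrt 3 * a" using assms(2) diameter_open_cube[OF a] by simp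
  \<comment> \<open>The bound T \<le> 4a that follows is what makes five images per axis
    enough.\<close>
  have "sqrt 3 \<le> 2" by (rule real_le_lsqrt) auto
  then have T4: "T \<le> 4 * a" using a by (simp add: T)
  have op: "open (open_cube a)"
  proof -
    have "open_cube a = box (\<chi> i. - a) (\<chi> i. a)" by (auto simp: open_cube_def mem_box_cart)
    then show ?thesis by (simp add: open_box)
  qed
  obtain g h where
    f: "\<And>y. (f has_derivative (\<lambda>v. \<Sum>i\<in>UNIV. v $ i * g i y)) (at y)"
    and g: "\<And>i y. (g i has_derivative (\<lambda>v. \<Sum>j\<in>UNIV. v $ j * h i j y)) (at y)"
    and h: "\<And>i j. continuous_on UNIV (h i j)"
    and 0: "\<And>y. y \<notin> open_cube a \<Longrightarrow> f y = 0" "\<And>i y. y \<notin> open_cube a \<Longrightarrow> g i y = 0"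
    by (rule C2_compact_supportE[OF op assms(3)]) blast
  have fc: "continuous_on UNIV f"
    using f by (meson continuous_at_imp_continuous_on has_derivative_continuous)
  define w where "w q = snd q * sphere_avg (\<lambda>_. 1) f q" for q
  define wt where "wt q = sphere_avg (\<lambda>_. 1) f q + snd q * (\<Sum>i\<in>UNIV. sphere_avg (\<lambda>z. sphere_point z $ i) (g i) q)" for q
  define wtt where "wtt q = 2 * (\<Sum>i\<in>UNIV. sphere_avg (\<lambda>z. sphere_point z $ i) (g i) q)
        + snd q * (\<Sum>i\<in>UNIV. \<Sum>j\<in>UNIV. sphere_avg (\<lambda>z. sphere_point z $ i * sphere_point z $ j) (h i j) q)" for q
  define wx where "wx i q = snd q * sphere_avg (\<lambda>_. 1) (g i) q" for i q
  interpret C2_wave w wt wtt wx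
     "\<lambda>i q. sphere_avg (\<lambda>_. 1) (g i) q + snd q * (\<Sum>j\<in>UNIV. sphere_avg (\<lambda>z. sphere_point z $ j) (h i j) q)"
     "\<lambda>i j q. snd q * sphere_avg (\<lambda>_. 1) (h i j) q"
    unfolding w_def[abs_def] wt_def[abs_def] wtt_def[abs_def] wx_def[abs_def]
    by (rule C2_wave_spherical_mean[OF f g h])
  have van: "w (y, t) = 0 \<and> wt (y, t) = 0 \<and> wx i (y, t) = 0" if "y \<in> closed_cube a" "T \<le> t" for y t i
    using that 0 by (simp add: w_def wt_def wx_def sphere_avg_eq_0[OF a] T)
  have P: "P y t = wt (y, t)" if "y \<in> frontier (open_cube a)" "0 \<le> t" for y t
  proof -
    have "(\<lambda>s. s * spherical_mean f y s) = (\<lambda>s. w (y, s))"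
      by (simp add: spherical_mean_eq[OF fc] w_def)
    then have "wave_solution f y t = wt (y, t)"
      unfolding wave_solution_def using DERIV_imp_deriv[OF time_derivative(1)] by simp
    then show ?thesis using assms(4,5) that by simp
  qed
  \<comment> \<open>\<open>S i\<close> is component i of the vector field under the divergence, as
    single layers over the two faces normal to axis i; \<open>D i\<close> is going to be its
    derivative in x_i.\<close>
  define S where "S i y = (\<Sum>\<sigma>\<in>{1, -1}. \<sigma> * (\<Sum>c\<in>{\<sigma> * a, - 3 * \<sigma> * a}.
    \<Sum>n\<in>{-2..2}. \<Sum>m\<in>{-2..2}. (-1) powi n * (-1) powi m *
      single_layer a i \<sigma> c (transverse_image a i n m y)))" for i y
  define D where "D i = (\<Sum>\<sigma>\<in>{1, -1}. \<sigma> * (\<Sum>c\<in>{\<sigma> * a, - 3 * \<sigma> * a}.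
    \<Sum>n\<in>{-2..2}. \<Sum>m\<in>{-2..2}. (-1) powi n * (-1) powi m *
      ((c - x $ i) * double_layer_deriv a i \<sigma> c (transverse_image a i n m x))))" for i
  have ne: "c \<noteq> y $ i" if "y \<in> open_cube a" "\<sigma> \<in> {1, -1}" "c \<in> {\<sigma> * a, - 3 * \<sigma> * a}" for y i \<sigma> c
  proof -
    have "- a < y $ i" "y $ i < a" using that(1) by (auto simp: open_cube_def)
    then show ?thesis using that(2,3) a by auto
  qed
  have face: "face_integral a P T i \<sigma> y = (\<sigma> * (\<Sum>c\<in>{\<sigma> * a, - 3 * \<sigma> * a}.
    \<Sum>n\<in>{-2..2}. \<Sum>m\<in>{-2..2}. (-1) powi n * (-1) powi m *
      single_layer a i \<sigma> c (transverse_image a i n m y))) *\<^sub>R axis i 1"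
    if y: "y \<in> open_cube a" and \<sigma>: "\<sigma> \<in> {1, -1}" for i \<sigma> y
  proof -
    have "face_integral a P T i \<sigma> y = (\<Sum>c\<in>{\<sigma> * a, - 3 * \<sigma> * a}.
      (\<Sum>n\<in>{-2..2}. \<Sum>m\<in>{-2..2}. (-1) powi n * (-1) powi m *
      single_layer a i \<sigma> c (transverse_image a i n m y)) *\<^sub>R face_normal i \<sigma>)"
      unfolding face_integral_def single_layer_def
      by (intro sum.cong refl plane_integral_eq[OF a T4 y \<sigma>] ne[OF y \<sigma>] vt_cont P)
        (use van in auto)
    then show ?thesis
      by (simp only: face_normal_def scaleR_sum_left[symmetric] scaleR_scaleR mult.commute[of _ \<sigma>])
        (simp only: sum_distrib_left)
  qed
  have comp: "(\<Sum>i\<in>UNIV. \<Sum>\<sigma>\<in>{1, -1}. face_integral a P T i \<sigma> y) $ k = S k y" if "y \<in> open_cube a" for y k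
  proof -
    have "(\<Sum>i\<in>UNIV. \<Sum>\<sigma>\<in>{1, -1}. face_integral a P T i \<sigma> y) = (\<Sum>i\<in>UNIV. S i y *\<^sub>R axis i 1)"
      unfolding S_def scaleR_sum_left[of _ "{1, -1}"] using face[OF that] by (intro sum.cong refl) auto
    then show ?thesis
      by (simp add: axis_def if_distrib[of "\<lambda>x. _ * x"] cong: if_cong)
  qed
  have der: "((\<lambda>s. (\<Sum>i\<in>UNIV. \<Sum>\<sigma>\<in>{1, -1}. face_integral a P T i \<sigma> (x + s *\<^sub>R axis k 1)) $ k)
      has_real_derivative D k) (at 0)" for k
  \<comment> \<open>The formula \<open>comp\<close> is available for points of the open cube only,
    so the derivative is transferred on the open set of those s for which x stays in the
    cube.\<close>
  proof (rule has_field_derivative_transform_within_open)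
    have "((\<lambda>s. single_layer a k \<sigma> c (transverse_image a k n m (x + s *\<^sub>R axis k 1))) has_real_derivative
        (c - x $ k) * double_layer_deriv a k \<sigma> c (transverse_image a k n m x)) (at 0)"
      if "\<sigma> \<in> {1, -1}" "c \<in> {\<sigma> * a, - 3 * \<sigma> * a}" for \<sigma> c n m
      using single_layer_has_derivative[of "transverse_image a k n m x" k c a \<sigma>] ne[OF x that, of k, symmetric]
      by (simp add: transverse_image_shift transverse_image_nth)
    then show "((\<lambda>s. S k (x + s *\<^sub>R axis k 1)) has_real_derivative D k) (at 0)"
      unfolding S_def D_def by (intro DERIV_sum DERIV_cmult)
    show "open {s. x + s *\<^sub>R axis k 1 \<in> open_cube a}"
      using continuous_open_preimage[OF _ open_UNIV op, of "\<lambda>s. x + s *\<^sub>R axis k 1"]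
      by (simp add: vimage_def continuous_intros)
    show "0 \<in> {s. x + s *\<^sub>R axis k 1 \<in> open_cube a}" using x by simp
    show "S k (x + s *\<^sub>R axis k 1) = (\<Sum>i\<in>UNIV. \<Sum>\<sigma>\<in>{1, -1}. face_integral a P T i \<sigma> (x + s *\<^sub>R axis k 1)) $ k"
      if "s \<in> {s. x + s *\<^sub>R axis k 1 \<in> open_cube a}" for s
      using that by (simp only: mem_Collect_eq comp)
  qed
  \<comment> \<open>At time 0 the second term of \<open>wt\<close> vanishes and the first is the
    average over a sphere of radius 0, which is f x.\<close>
  have "2 * pi * wt (x, 0) = (\<Sum>i\<in>UNIV. D i)"
    unfolding D_def using van T4 by (intro double_layer_deriv_representation[OF a x]) auto
  then have "f x = 1 / (2 * pi) * (\<Sum>i\<in>UNIV. D i)"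
    by (simp add: wt_def sphere_avg_at_0 field_simps)
  then show ?thesis
    using der unfolding has_divergence_def by blast
qed

end
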